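(* For each integer $k\ge1$ there exists a real constant $B(k)$, depending only on $k$, such that \[ \frac{1}{N(Q)}\sum_{i=1}^{N(Q)}\nu_k(\gamma_i)=B(k)+O_k\!\left(\frac{(\log Q)^2}{Q}\right)\quad\text{as } Q\to\infty, \] where the implied constant depends only on $k$.
   Context: For $Q\in\mathbb{N}$, the Farey fractions of order $Q$ are $\mathcal{F}_Q=\{a/q\in\mathbb{Q}: 1\le q\le Q,\ 0<a\le q,\ \gcd(a,q)=1\}$, and $N(Q)=\#\mathcal{F}_Q$. Write $\mathcal{F}_Q=\{\gamma_1,\ldots,\gamma_{N(Q)}\}$ with $1/Q=\gamma_1<\gamma_2<\cdots<\gamma_{N(Q)}=1$, and extend to all $i\in\mathbb{Z}$ by $\gamma_{i+N(Q)}=\gamma_i+1$. For each $i$ write $\gamma_i=p_i/q_i$ in lowest terms with $q_i>0$. For a positive integer $k$, the $k$-index of $\gamma_i$ (relative to $Q$) is $\nu_k(\gamma_i)=p_{i+k-1}q_{i-1}-p_{i-1}q_{i+k-1}$. *)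

theory Defs
  imports "HOL-Analysis.Analysis" "HOL-Library.Landau_Symbols"
begin

definition farey :: "nat \<Rightarrow> rat set" where
  "farey Q = {r. 0 < r \<and> r \<le> 1 \<and> snd (quotient_of r) \<le> int Q}"

definition farey_N :: "nat \<Rightarrow> nat" where
  "farey_N Q = card (farey Q)"

text \<open>gamma Q i for i :: int: gamma_1 < ... < gamma_N are the Farey fractions in increasing order,
  extended by gamma_(i+N) = gamma_i + 1.\<close>
definition farey_gamma :: "nat \<Rightarrow> int \<Rightarrow> rat" where
  "farey_gamma Q i =
     (let n = int (farey_N Q)
      in sorted_list_of_set (farey Q) ! nat ((i - 1) mod n) + of_int ((i - 1) div n))"

definition farey_p :: "nat \<Rightarrow> int \<Rightarrow> int" where
  "farey_p Q i = fst (quotient_of (farey_gamma Q i))"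

definition farey_q :: "nat \<Rightarrow> int \<Rightarrow> int" where
  "farey_q Q i = snd (quotient_of (farey_gamma Q i))"

definition k_index :: "nat \<Rightarrow> nat \<Rightarrow> int \<Rightarrow> int" where
  "k_index Q k i =
     farey_p Q (i + int k - 1) * farey_q Q (i - 1) - farey_p Q (i - 1) * farey_q Q (i + int k - 1)"

end

theory Submission
  imports Defs "HOL-Real_Asymp.Real_Asymp" "HOL-Computational_Algebra.Squarefree"
begin

text \<open>The pairs \<open>(q\<^sub>i\<^sub>-\<^sub>1, q\<^sub>i)\<close> of neighbouring denominators run exactly once through the coprime points of the triangle
  \<open>a, b \<le> Q < a + b\<close>, and the \<open>k\<close>-index is a continuant in the 2-indices of \<open>k - 1\<close> consecutive fractions. A 2-index larger than
  \<open>4 k + 2\<close> comes from a very small denominator, which forces the surrounding 2-indices to be \<open>\<dots>, 2, 2, 1, j, 1, 2, 2, \<dots>\<close>; then the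
  \<open>k\<close>-index equals \<open>j - k + 2\<close>. Such large contributions are summed by the Hall--Shiu identity: the 2-indices add up to \<open>3 N - 1\<close>.
  What is left is a bounded function of \<open>(a / Q, b / Q)\<close> that is constant on the faces of a finite line arrangement. Its sum
  over the points of a mesh of width \<open>d / Q\<close> agrees, up to the factor \<open>d\<^sup>2\<close>, with the sum over the mesh \<open>1 / Q\<close> up to cells that meet
  a line, so Moebius inversion gives the sum over coprime points with error \<open>O(Q log Q)\<close>.\<close>

section \<open>Sums of sign-determined functions over lattice points\<close>

text \<open>The \<open>k\<close>-index is unbounded, and cutting the triangle by the values of all
  2-indices takes infinitely many lines, so no lattice point count with a uniform error applies
  directly. Capping the 2-indices at \<open>4 * k + 2\<close> leaves finitely many lines, but the
  discarded part contributes to the main term and cannot be treated as an error. It is recovered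
  exactly: the Hall-Shiu total minus the sum over small 2-indices, which is again tame. Over a
  period every 2-index enters \<open>k - 1\<close> of the \<open>k\<close>-indices, which produces
  the constant \<open>(k - 1) * (5 - k)\<close> beside the mean of a bounded function. That mean is
  taken over a triangle of area 1/2, hence \<open>2 * I\<close>. Subtracting it before the Moebius
  inversion makes the integral vanish, so the sum of \<open>mu d / d\<^sup>2\<close> has to be
  bounded but never evaluated, and for \<open>N(Q)\<close> a lower bound of order
  \<open>Q\<^sup>2\<close> suffices. The error obtained is in fact
  \<open>O(log Q / Q)\<close>.\<close>

type_synonym form = "int \<times> int \<times> int"

definition lin :: "form \<Rightarrow> int \<Rightarrow> int \<Rightarrow> int \<Rightarrow> int" where
  "lin L Q a b = (case L of (u, v, w) \<Rightarrow> u * a + v * b + w * Q)"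

text \<open>A function that depends only on the signs of finitely many integer linear forms in \<open>(Q, a, b)\<close>. This captures
  bounded functions of \<open>(a / Q, b / Q)\<close> that are constant on the faces of a finite line arrangement, with no reference to
  geometry or measure, and makes homogeneity automatic.\<close>

definition tame :: "(int \<Rightarrow> int \<Rightarrow> int \<Rightarrow> real) \<Rightarrow> bool" where
  "tame f \<longleftrightarrow> (\<exists>\<L> M. finite \<L> \<and> (\<forall>Q a b. \<bar>f Q a b\<bar> \<le> M) \<and>
     (\<forall>Q a b Q' a' b'. (\<forall>L\<in>\<L>. sgn (lin L Q a b) = sgn (lin L Q' a' b')) \<longrightarrow> f Q a b = f Q' a' b'))"

lemma tame_const: "tame (\<lambda>_ _ _. c)"
  unfolding tame_def by (intro exI[of _ "{}"] exI[of _ "\<bar>c\<bar>"]) auto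

lemma tame_add:
  assumes "tame f" "tame g"
  shows "tame (\<lambda>Q a b. f Q a b + g Q a b)"
proof -
  obtain \<L> M where f: "finite \<L>" "\<And>Q a b. \<bar>f Q a b\<bar> \<le> M"
    "\<And>Q a b Q' a' b'. (\<forall>L\<in>\<L>. sgn (lin L Q a b) = sgn (lin L Q' a' b')) \<Longrightarrow> f Q a b = f Q' a' b'"
    using assms(1) unfolding tame_def by metis
  obtain \<K> M' where g: "finite \<K>" "\<And>Q a b. \<bar>g Q a b\<bar> \<le> M'"
    "\<And>Q a b Q' a' b'. (\<forall>L\<in>\<K>. sgn (lin L Q a b) = sgn (lin L Q' a' b')) \<Longrightarrow> g Q a b = g Q' a' b'"
    using assms(2) unfolding tame_def by metis
  show ?thesis unfolding tame_def
  proof (intro exI[of _ "\<L> \<union> \<K>"] exI[of _ "M + M'"] conjI allI impI)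
    show "\<bar>f Q a b + g Q a b\<bar> \<le> M + M'" for Q a b
      using f(2)[of Q a b] g(2)[of Q a b] by linarith
    show "f Q a b + g Q a b = f Q' a' b' + g Q' a' b'"
      if "\<forall>L\<in>\<L> \<union> \<K>. sgn (lin L Q a b) = sgn (lin L Q' a' b')" for Q a b Q' a' b'
      using f(3) g(3) that by (metis UnCI)
  qed (use f g in auto)
qed

lemma tame_mult:
  assumes "tame f" "tame g"
  shows "tame (\<lambda>Q a b. f Q a b * g Q a b)"
proof -
  obtain \<L> M where f: "finite \<L>" "\<And>Q a b. \<bar>f Q a b\<bar> \<le> M"
    "\<And>Q a b Q' a' b'. (\<forall>L\<in>\<L>. sgn (lin L Q a b) = sgn (lin L Q' a' b')) \<Longrightarrow> f Q a b = f Q' a' b'"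
    using assms(1) unfolding tame_def by metis
  obtain \<K> M' where g: "finite \<K>" "\<And>Q a b. \<bar>g Q a b\<bar> \<le> M'"
    "\<And>Q a b Q' a' b'. (\<forall>L\<in>\<K>. sgn (lin L Q a b) = sgn (lin L Q' a' b')) \<Longrightarrow> g Q a b = g Q' a' b'"
    using assms(2) unfolding tame_def by metis
  show ?thesis unfolding tame_def
  proof (intro exI[of _ "\<L> \<union> \<K>"] exI[of _ "M * M'"] conjI allI impI)
    show "\<bar>f Q a b * g Q a b\<bar> \<le> M * M'" for Q a b
      using f(2)[of Q a b] g(2)[of Q a b] by (auto simp: abs_mult intro!: mult_mono)
    show "f Q a b * g Q a b = f Q' a' b' * g Q' a' b'"
      if "\<forall>L\<in>\<L> \<union> \<K>. sgn (lin L Q a b) = sgn (lin L Q' a' b')" for Q a b Q' a' b'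
      using f(3) g(3) that by (metis UnCI)
  qed (use f g in auto)
qed

lemma tame_sum:
  assumes "finite S" "\<And>s. s \<in> S \<Longrightarrow> tame (f s)"
  shows "tame (\<lambda>Q a b. \<Sum>s\<in>S. f s Q a b)"
  using assms by (induction S rule: finite_induct) (auto intro: tame_const tame_add)

lemma tame_indicator: "tame (\<lambda>Q a b. of_bool (lin L Q a b \<ge> 0))"
  unfolding tame_def
proof (intro exI[of _ "{L}"] exI[of _ 1] conjI allI impI)
  show "(of_bool (lin L Q a b \<ge> 0) :: real) = of_bool (lin L Q' a' b' \<ge> 0)"
    if "\<forall>L\<in>{L}. sgn (lin L Q a b) = sgn (lin L Q' a' b')" for Q a b Q' a' b'
    using that by (auto simp: sgn_if split: if_splits)
qed auto

lemma tame_not_indicator: "tame (\<lambda>Q a b. of_bool (lin L Q a b < 0))"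
proof -
  have "tame (\<lambda>Q a b. 1 + (-1) * of_bool (lin L Q a b \<ge> 0))"
    by (intro tame_add tame_mult tame_const tame_indicator)
  also have "(\<lambda>Q a b. 1 + (-1) * of_bool (lin L Q a b \<ge> 0)) = (\<lambda>Q a b. of_bool (lin L Q a b < 0) :: real)"
    by (auto simp: fun_eq_iff)
  finally show ?thesis .
qed

text \<open>Scaling by a positive factor changes no sign of a linear form. This identifies the level
  \<open>Q\<close> sum with a sum over a coarse mesh at level \<open>m * Q\<close>.\<close>

lemma tame_homogeneous:
  assumes "tame f" "m \<ge> 1"
  shows "f (m * Q) (m * a) (m * b) = f Q a b"
proof -
  have "lin L (m * Q) (m * a) (m * b) = m * lin L Q a b" for L
    by (auto simp: lin_def algebra_simps split: prod.splits)
  hence "sgn (lin L (m * Q) (m * a) (m * b)) = sgn (lin L Q a b)" for L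
    using assms(2) by (simp add: sgn_mult)
  thus ?thesis using assms(1) unfolding tame_def by metis
qed

text \<open>Blocks are indexed downwards from their right end \<open>d * a\<close>, so that each
  contains the coarse mesh point that will represent it.\<close>

lemma sum_blocks:
  fixes g :: "int \<Rightarrow> real"
  assumes "d \<ge> 1" "n \<ge> 0"
  shows "(\<Sum>a\<in>{1..d * n}. g a) = (\<Sum>a\<in>{1..n}. \<Sum>s\<in>{0..<d}. g (d * a - s))"
  using assms(2)
proof (induction n rule: int_ge_induct)
  case (step n)
  have "{1..d * (n + 1)} = {1..d * n} \<union> {d * n + 1..d * n + d}"
    using assms(1) step by (auto simp: algebra_simps) (smt (verit) mult_nonneg_nonneg)
  moreover have "(\<Sum>a\<in>{d * n + 1..d * n + d}. g a) = (\<Sum>s\<in>{0..<d}. g (d * (n + 1) - s))"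
    by (rule sum.reindex_bij_witness[of _ "\<lambda>s. d * (n + 1) - s" "\<lambda>a. d * (n + 1) - a"])
       (auto simp: algebra_simps)
  moreover have "{1..n+1} = insert (n+1) {1..n}" using step by auto
  ultimately show ?case using step.IH
    by (simp add: sum.union_disjoint)
qed auto

text \<open>The value of the form and one coordinate with the other coefficient nonzero determine
  the point, and only \<open>2 * K + 2\<close> values are possible.\<close>

lemma card_near_form:
  fixes u v c K d n :: int
  assumes "d \<ge> 1" "n \<ge> 0" "K \<ge> 0" "(u, v) \<noteq> (0, 0)"
  shows "real (card {(a, b) \<in> {1..n} \<times> {1..n}. \<bar>d * (u * a + v * b) + c\<bar> \<le> K * d}) \<le> n * (2 * K + 2)"
proof -
  define S where "S = {(a, b) \<in> {1..n} \<times> {1..n}. \<bar>d * (u * a + v * b) + c\<bar> \<le> K * d}"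
  \<comment> \<open>The floor of \<open>- c / d\<close>; its fractional part accounts for the extra
    1 in the upper end \<open>l + K + 1\<close>.\<close>
  define l where "l = (- c) div d"
  have range: "u * a + v * b \<in> {l - K..l + K + 1}" if "(a, b) \<in> S" for a b
  proof -
    have *: "- c = d * l + (- c) mod d" "0 \<le> (- c) mod d" "(- c) mod d < d"
      using assms(1) by (auto simp: l_def)
    define e where "e = u * a + v * b"
    have "\<bar>d * e + c\<bar> \<le> K * d" using that by (auto simp: S_def e_def)
    hence "d * e \<le> d * (l + K) + (- c) mod d" "d * (l - K) \<le> d * e"
      using * by (auto simp: algebra_simps abs_le_iff)
    hence "d * e < d * (l + K + 1)" "d * (l - K) \<le> d * e" using *(3) by (auto simp: algebra_simps)
    thus ?thesis using assms(1) by (auto simp: e_def)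
  qed
  have "card S \<le> card ({1..n} \<times> {l - K..l + K + 1})"
  proof (cases "v = 0")
    case False
    show ?thesis
    proof (rule card_inj_on_le[of "\<lambda>(a, b). (a, u * a + v * b)"])
      show "inj_on (\<lambda>(a, b). (a, u * a + v * b)) S" using False by (auto simp: inj_on_def)
      show "(\<lambda>(a, b). (a, u * a + v * b)) ` S \<subseteq> {1..n} \<times> {l - K..l + K + 1}"
        using range by (auto simp: S_def)
    qed auto
  next
    case True
    hence "u \<noteq> 0" using assms(4) by auto
    show ?thesis
    proof (rule card_inj_on_le[of "\<lambda>(a, b). (b, u * a + v * b)"])
      show "inj_on (\<lambda>(a, b). (b, u * a + v * b)) S" using \<open>u \<noteq> 0\<close> by (auto simp: inj_on_def)
      show "(\<lambda>(a, b). (b, u * a + v * b)) ` S \<subseteq> {1..n} \<times> {l - K..l + K + 1}"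
        using range by (auto simp: S_def)
    qed auto
  qed
  also have "\<dots> = nat (n * (2 * K + 2))"
    using assms by (simp add: card_cartesian_product nat_mult_distrib add_ac mult_ac)
  finally have "int (card S) \<le> n * (2 * K + 2)"
    using assms zero_le_mult_iff[of n "2 * K + 2"] by (simp add: le_nat_iff)
  hence "real (card S) \<le> real_of_int (n * (2 * K + 2))" by linarith
  thus ?thesis unfolding S_def by simp
qed

text \<open>A cell of side \<open>d\<close> contributes to the difference only if one of the lines meets it, and each line meets
  \<open>O(n)\<close> of the \<open>n\<^sup>2\<close> cells.\<close>

lemma tame_mesh:
  assumes "tame f"
  obtains C :: real where "C \<ge> 0"
    "\<And>d n Q. d \<ge> 1 \<Longrightarrow> n \<ge> 0 \<Longrightarrow>
      \<bar>(real_of_int d)\<^sup>2 * (\<Sum>a\<in>{1..n}. \<Sum>b\<in>{1..n}. f Q (d * a) (d * b))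
        - (\<Sum>a\<in>{1..d * n}. \<Sum>b\<in>{1..d * n}. f Q a b)\<bar> \<le> C * (real_of_int d)\<^sup>2 * real_of_int n"
proof -
  obtain \<L> M where f: "finite \<L>" "\<And>Q a b. \<bar>f Q a b\<bar> \<le> M"
    "\<And>Q a b Q' a' b'. (\<forall>L\<in>\<L>. sgn (lin L Q a b) = sgn (lin L Q' a' b')) \<Longrightarrow> f Q a b = f Q' a' b'"
    using assms unfolding tame_def by metis
  have M: "M \<ge> 0" using f(2)[of 0 0 0] by linarith
  \<comment> \<open>A form with \<open>u = v = 0\<close> has the same sign at all points of one
    level \<open>Q\<close>, so it separates nothing.\<close>
  define \<N> where "\<N> = {L \<in> \<L>. (fst L, fst (snd L)) \<noteq> (0, 0)}"
  have fN: "finite \<N>" using f(1) by (simp add: \<N>_def)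
  \<comment> \<open>\<open>h L * d\<close> bounds the change of the form over one cell, so a cell
    whose corner value is larger in absolute value lies strictly on one side of the line.\<close>
  define h :: "form \<Rightarrow> int" where "h L = \<bar>fst L\<bar> + \<bar>fst (snd L)\<bar>" for L
  \<comment> \<open>\<open>2 * M\<close> bounds the oscillation of \<open>f\<close>; the sum bounds
    the number of cells meeting a line, per unit of \<open>n\<close>.\<close>
  define C where "C = 2 * M * (\<Sum>L\<in>\<N>. 2 * h L + 2)"
  show ?thesis
  proof (rule that)
    have "(\<Sum>L\<in>\<N>. 2 * h L + 2) \<ge> 0" by (intro sum_nonneg) (auto simp: h_def)
    thus "C \<ge> 0" using M by (simp add: C_def del: of_int_sum)
    fix d n Q :: int assume d: "d \<ge> 1" and n: "n \<ge> 0"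
    define S where "S L = {(a, b) \<in> {1..n} \<times> {1..n}. \<bar>d * (fst L * a + fst (snd L) * b) + snd (snd L) * Q\<bar> \<le> h L * d}" for L
    have finS: "finite (S L)" for L
      by (rule finite_subset[of _ "{1..n} \<times> {1..n}"]) (auto simp: S_def)
    define X where "X = (\<Union>L\<in>\<N>. S L)"
    have good: "f Q (d * a) (d * b) = f Q (d * a - s) (d * b - t)"
      if ab: "a \<in> {1..n}" "b \<in> {1..n}" and st: "s \<in> {0..<d}" "t \<in> {0..<d}" and nX: "(a, b) \<notin> X" for a b s t
    proof (rule f(3), intro ballI)
      fix L assume L: "L \<in> \<L>"
      obtain u v w where uvw: "L = (u, v, w)" by (cases L)
      define z where "z = lin L Q (d * a) (d * b)"
      have z': "lin L Q (d * a - s) (d * b - t) = z - (u * s + v * t)"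
        by (simp add: z_def lin_def uvw algebra_simps)
      show "sgn (lin L Q (d * a) (d * b)) = sgn (lin L Q (d * a - s) (d * b - t))"
      proof (cases "L \<in> \<N>")
        case False
        hence "u = 0" "v = 0" using L by (auto simp: \<N>_def uvw)
        thus ?thesis by (simp add: lin_def uvw)
      next
        case True
        have "\<bar>u * s + v * t\<bar> \<le> \<bar>u\<bar> * s + \<bar>v\<bar> * t"
          using st abs_triangle_ineq[of "u * s" "v * t"] by (simp add: abs_mult)
        also have "\<dots> \<le> \<bar>u\<bar> * d + \<bar>v\<bar> * d" using st by (intro add_mono mult_left_mono) auto
        also have "\<dots> < \<bar>z\<bar>"
          using nX True ab by (auto simp: X_def S_def h_def uvw z_def lin_def algebra_simps)
        finally show ?thesis unfolding z' z_def[symmetric] by (auto simp: sgn_if)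
      qed
    qed
    have "card X \<le> (\<Sum>L\<in>\<N>. card (S L))"
      unfolding X_def by (rule card_UN_le[OF fN])
    hence "real (card X) \<le> (\<Sum>L\<in>\<N>. real (card (S L)))"
      by (metis of_nat_le_iff of_nat_sum)
    also have "\<dots> \<le> (\<Sum>L\<in>\<N>. n * (2 * h L + 2))"
    proof -
      have "real (card (S L)) \<le> n * (2 * h L + 2)" if "L \<in> \<N>" for L
        unfolding S_def using d n that by (intro card_near_form) (auto simp: h_def \<N>_def)
      thus ?thesis by (simp only: of_int_sum) (intro sum_mono, blast)
    qed
    also have "\<dots> = n * (\<Sum>L\<in>\<N>. 2 * h L + 2)" by (simp only: sum_distrib_left of_int_mult)
    finally have cardX: "real (card X) \<le> n * (\<Sum>L\<in>\<N>. 2 * h L + 2)" .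
    define D where "D a b = (\<Sum>s\<in>{0..<d}. \<Sum>t\<in>{0..<d}. f Q (d * a) (d * b) - f Q (d * a - s) (d * b - t))" for a b
    have D: "\<bar>D a b\<bar> \<le> (if (a, b) \<in> X then 2 * M * (real_of_int d)\<^sup>2 else 0)" if "a \<in> {1..n}" "b \<in> {1..n}" for a b
    proof (cases "(a, b) \<in> X")
      case False
      have "f Q (d * a) (d * b) - f Q (d * a - s) (d * b - t) = 0"
      if "s \<in> {0..<d}" "t \<in> {0..<d}" for s t
      using good[OF \<open>a \<in> {1..n}\<close> \<open>b \<in> {1..n}\<close> that False] by simp
    hence "D a b = 0" unfolding D_def by (intro sum.neutral ballI)
      thus ?thesis using False by simp
    next
      case True
      have "\<bar>D a b\<bar> \<le> (\<Sum>s\<in>{0..<d}. \<Sum>t\<in>{0..<d}. \<bar>f Q (d * a) (d * b) - f Q (d * a - s) (d * b - t)\<bar>)"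
        unfolding D_def by (intro order.trans[OF sum_abs] sum_mono order.refl)
      also have "\<dots> \<le> (\<Sum>s\<in>{0..<d}. \<Sum>t\<in>{0..<d}. 2 * M)"
      proof (intro sum_mono)
        show "\<bar>f Q (d * a) (d * b) - f Q (d * a - s) (d * b - t)\<bar> \<le> 2 * M" for s t
          using f(2)[of Q "d * a" "d * b"] f(2)[of Q "d * a - s" "d * b - t"] by linarith
      qed
      also have "\<dots> = 2 * M * (real_of_int d)\<^sup>2" using d by (simp add: power2_eq_square)
      finally show ?thesis using True by simp
    qed
    have "(\<Sum>a\<in>{1..d * n}. \<Sum>b\<in>{1..d * n}. f Q a b) =
        (\<Sum>a\<in>{1..n}. \<Sum>s\<in>{0..<d}. \<Sum>b\<in>{1..n}. \<Sum>t\<in>{0..<d}. f Q (d * a - s) (d * b - t))"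
      by (simp only: sum_blocks[OF d n])
    also have "\<dots> = (\<Sum>a\<in>{1..n}. \<Sum>b\<in>{1..n}. \<Sum>s\<in>{0..<d}. \<Sum>t\<in>{0..<d}. f Q (d * a - s) (d * b - t))"
      by (intro sum.cong refl sum.swap)
    finally have "(real_of_int d)\<^sup>2 * (\<Sum>a\<in>{1..n}. \<Sum>b\<in>{1..n}. f Q (d * a) (d * b))
        - (\<Sum>a\<in>{1..d * n}. \<Sum>b\<in>{1..d * n}. f Q a b) = (\<Sum>a\<in>{1..n}. \<Sum>b\<in>{1..n}. D a b)"
      using d by (simp add: D_def sum_subtractf sum_distrib_left power2_eq_square mult.assoc)
    also have "\<bar>\<dots>\<bar> \<le> (\<Sum>a\<in>{1..n}. \<Sum>b\<in>{1..n}. \<bar>D a b\<bar>)"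
      by (intro order.trans[OF sum_abs] sum_mono order.refl)
    also have "\<dots> \<le> (\<Sum>a\<in>{1..n}. \<Sum>b\<in>{1..n}. if (a, b) \<in> X then 2 * M * (real_of_int d)\<^sup>2 else 0)"
      by (intro sum_mono D)
    also have "\<dots> = (\<Sum>x\<in>{1..n} \<times> {1..n}. if x \<in> X then 2 * M * (real_of_int d)\<^sup>2 else 0)"
      by (simp add: sum.cartesian_product)
    also have "\<dots> = (\<Sum>x\<in>X. 2 * M * (real_of_int d)\<^sup>2)"
    proof -
      have "({1..n} \<times> {1..n}) \<inter> X = X" by (auto simp: X_def S_def)
      thus ?thesis by (subst sum.inter_restrict[symmetric]) auto
    qed
    also have "\<dots> = real (card X) * (2 * M * (real_of_int d)\<^sup>2)" by simp
    also have "\<dots> \<le> n * (\<Sum>L\<in>\<N>. 2 * h L + 2) * (2 * M * (real_of_int d)\<^sup>2)"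
      using M by (intro mult_right_mono cardX) auto
    also have "\<dots> = C * (real_of_int d)\<^sup>2 * real_of_int n" by (simp add: C_def algebra_simps del: of_int_sum)
    finally show "\<bar>(real_of_int d)\<^sup>2 * (\<Sum>a\<in>{1..n}. \<Sum>b\<in>{1..n}. f Q (d * a) (d * b))
        - (\<Sum>a\<in>{1..d * n}. \<Sum>b\<in>{1..d * n}. f Q a b)\<bar> \<le> C * (real_of_int d)\<^sup>2 * real_of_int n" .
  qed
qed

text \<open>Comparing the meshes \<open>1 / Q\<close> and \<open>1 / (m * Q)\<close> makes the normalised sums a Cauchy sequence; \<open>I\<close> is the integral of
  \<open>f\<close> over the unit square.\<close>

lemma tame_limit:
  assumes "tame f"
  obtains I C :: real where "C \<ge> 0"
    "\<And>Q. Q \<ge> 1 \<Longrightarrow> \<bar>(\<Sum>a\<in>{1..Q}. \<Sum>b\<in>{1..Q}. f Q a b) - I * (real_of_int Q)\<^sup>2\<bar> \<le> C * real_of_int Q"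
proof -
  obtain C :: real where C: "C \<ge> 0"
    "\<And>d n Q. d \<ge> 1 \<Longrightarrow> n \<ge> 0 \<Longrightarrow>
      \<bar>(real_of_int d)\<^sup>2 * (\<Sum>a\<in>{1..n}. \<Sum>b\<in>{1..n}. f Q (d * a) (d * b))
        - (\<Sum>a\<in>{1..d * n}. \<Sum>b\<in>{1..d * n}. f Q a b)\<bar> \<le> C * (real_of_int d)\<^sup>2 * real_of_int n"
    using tame_mesh[OF assms] by metis
  define F where "F Q = (\<Sum>a\<in>{1..Q}. \<Sum>b\<in>{1..Q}. f Q a b)" for Q
  define u where "u Q = F Q / Q\<^sup>2" for Q :: int
  \<comment> \<open>Mesh comparison at level \<open>m * Q\<close> with \<open>d = m\<close> and
    \<open>n = Q\<close>; by homogeneity the coarse sum is \<open>F Q\<close>.\<close>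
  have 1: "\<bar>u Q - u (m * Q)\<bar> \<le> C / Q" if "Q \<ge> 1" "m \<ge> 1" for Q m :: int
  proof -
    have "\<bar>m\<^sup>2 * F Q - F (m * Q)\<bar> \<le> C * m\<^sup>2 * Q"
      using C(2)[of m Q "m * Q"] that by (simp add: F_def tame_homogeneous[OF assms])
    hence "\<bar>m\<^sup>2 * F Q - F (m * Q)\<bar> / (m\<^sup>2 * Q\<^sup>2) \<le> C * m\<^sup>2 * Q / (m\<^sup>2 * Q\<^sup>2)"
      using that by (intro divide_right_mono) auto
    also have "\<dots> = C / Q" using that by (simp add: power2_eq_square)
    also have "\<bar>m\<^sup>2 * F Q - F (m * Q)\<bar> / (m\<^sup>2 * Q\<^sup>2) = \<bar>(m\<^sup>2 * F Q - F (m * Q)) / (m\<^sup>2 * Q\<^sup>2)\<bar>"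
      by (simp add: abs_mult)
    also have "(m\<^sup>2 * F Q - F (m * Q)) / (m\<^sup>2 * Q\<^sup>2) = u Q - u (m * Q)"
      using that by (simp add: u_def diff_divide_distrib power_mult_distrib)
    finally show ?thesis .
  qed
  \<comment> \<open>Both levels are compared with the common refinement
    \<open>Q * R\<close>.\<close>
  have 2: "\<bar>u Q - u R\<bar> \<le> C / Q + C / R" if "Q \<ge> 1" "R \<ge> 1" for Q R :: int
    using 1[of Q R] 1[of R Q] that by (simp add: mult.commute)
  define v where "v n = u (int n + 1)" for n
  have v: "\<bar>v m - v n\<bar> \<le> C / (real m + 1) + C / (real n + 1)" for m n
    using 2[of "int m + 1" "int n + 1"] by (simp add: v_def add_ac)
  have "Cauchy v"
  proof (rule metric_CauchyI)
    fix e :: real assume e: "e > 0"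
    obtain N :: nat where N: "N > 2 * C / e" using reals_Archimedean2 by blast
    have *: "C / (real m + 1) < e / 2" if "m \<ge> N" for m
    proof -
      have "2 * C / e < real m + 1" using N that by linarith
      thus ?thesis using e by (simp add: field_simps)
    qed
    show "\<exists>N. \<forall>m\<ge>N. \<forall>n\<ge>N. dist (v m) (v n) < e"
    proof (intro exI allI impI)
      fix m n assume "m \<ge> N" "n \<ge> N"
      thus "dist (v m) (v n) < e"
        unfolding dist_real_def using v[of m n] *[of m] *[of n] by linarith
    qed
  qed
  then obtain I where I: "v \<longlonglongrightarrow> I" using Cauchy_convergent convergent_def by blast
  have 3: "\<bar>u Q - I\<bar> \<le> C / Q" if "Q \<ge> 1" for Q
  proof (rule tendsto_le[of sequentially])
    show "(\<lambda>n. \<bar>u Q - v n\<bar>) \<longlonglongrightarrow> \<bar>u Q - I\<bar>" by (intro tendsto_intros I)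
    show "(\<lambda>n. C / Q + C / (real n + 1)) \<longlonglongrightarrow> C / Q" by real_asymp
    show "\<forall>\<^sub>F n in sequentially. \<bar>u Q - v n\<bar> \<le> C / Q + C / (real n + 1)"
    proof (intro always_eventually allI)
      show "\<bar>u Q - v n\<bar> \<le> C / Q + C / (real n + 1)" for n
        using 2[OF that, of "int n + 1"] by (simp add: v_def)
    qed
  qed auto
  show ?thesis
  proof (rule that[of C I])
    fix Q :: int assume Q: "Q \<ge> 1"
    have "F Q - I * Q\<^sup>2 = (u Q - I) * Q\<^sup>2"
      using Q by (simp add: u_def left_diff_distrib)
    hence "\<bar>F Q - I * Q\<^sup>2\<bar> = \<bar>u Q - I\<bar> * Q\<^sup>2" by (simp add: abs_mult)
    also have "\<dots> \<le> C / Q * Q\<^sup>2" by (intro mult_right_mono 3 Q) auto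
    also have "\<dots> = C * Q" using Q by (simp add: power2_eq_square)
    finally show "\<bar>(\<Sum>a\<in>{1..Q}. \<Sum>b\<in>{1..Q}. f Q a b) - I * (real_of_int Q)\<^sup>2\<bar> \<le> C * real_of_int Q" by (simp add: F_def)
  qed (rule C)
qed

section \<open>Coprime lattice points\<close>

definition mu :: "nat \<Rightarrow> real" where
  "mu n = (if squarefree n then (- 1) ^ card (prime_factors n) else 0)"

lemma abs_mu_le: "\<bar>mu n\<bar> \<le> 1"
  by (simp add: mu_def)

lemma mu_1 [simp]: "mu (Suc 0) = 1"
  by (simp add: mu_def)

lemma prime_factors_prod_primes:
  fixes P :: "nat set"
  assumes "finite P" "\<And>p. p \<in> P \<Longrightarrow> prime p"
  shows "prime_factors (\<Prod>P) = P"
proof -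
  have "prime_factors (\<Prod>p\<in>P. p) = (\<Union>p\<in>P. prime_factors p)"
    using assms not_prime_0 by (subst prime_factors_prod) (auto, metis not_prime_0)
  also have "\<dots> = P" using assms(2) by (auto simp: prime_prime_factors)
  finally show ?thesis by simp
qed

lemma squarefree_imp_prod_prime_factors:
  assumes "squarefree (n :: nat)"
  shows "\<Prod>(prime_factors n) = n"
proof -
  have n: "n \<noteq> 0" using assms by (metis not_squarefree_0)
  have "\<Prod>(prime_factors n) = (\<Prod>p\<in>prime_factors n. p ^ multiplicity p n)"
    using assms n by (intro prod.cong) (auto simp: squarefree_factorial_semiring')
  also have "\<dots> = n" using n by (simp add: prod_prime_factors)
  finally show ?thesis .
qed

text \<open>Squarefree divisors correspond to subsets of the prime factors, so the sum is the
  expansion of a product of factors \<open>- 1 + 1\<close>.\<close>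

lemma sum_mu_divisors:
  assumes "n > 0"
  shows "(\<Sum>d | d dvd n. mu d) = of_bool (n = 1)"
proof -
  have fin: "finite {d. d dvd n}" using assms by simp
  have sub: "d \<noteq> 0" if "d dvd n" for d using that assms by auto
  have "(\<Sum>d | d dvd n. mu d) = (\<Sum>d | d dvd n \<and> squarefree d. (- 1) ^ card (prime_factors d))"
    using fin by (intro sum.mono_neutral_cong_right) (auto simp: mu_def)
  also have "\<dots> = (\<Sum>X\<in>Pow (prime_factors n). (- 1) ^ card X)"
  proof (rule sum.reindex_bij_witness[of _ "\<lambda>X. \<Prod>X" prime_factors])
    fix d assume d: "d \<in> {d. d dvd n \<and> squarefree d}"
    thus "\<Prod>(prime_factors d) = d" by (intro squarefree_imp_prod_prime_factors) auto
    show "prime_factors d \<in> Pow (prime_factors n)"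
      using d assms by (auto intro: dvd_prime_factors[THEN subsetD])
  next
    fix X assume X: "X \<in> Pow (prime_factors n)"
    hence fX: "finite X" and pX: "\<And>p. p \<in> X \<Longrightarrow> prime p" by (auto intro: finite_subset)
    show "prime_factors (\<Prod>X) = X" using fX pX by (rule prime_factors_prod_primes)
    have "squarefree (\<Prod>p\<in>X. p)"
      using pX by (intro squarefree_prod_coprime primes_coprime squarefree_prime) auto
    moreover have "\<Prod>X dvd n"
    proof -
      have "\<Prod>X dvd \<Prod>(prime_factors n)" using X by (intro prod_dvd_prod_subset) auto
      also have "\<dots> dvd (\<Prod>p\<in>prime_factors n. p ^ multiplicity p n)"
        by (intro prod_dvd_prod dvd_power) (auto simp: prime_factors_multiplicity)
      also have "\<dots> = n" using assms by (simp add: prod_prime_factors)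
      finally show ?thesis .
    qed
    ultimately show "\<Prod>X \<in> {d. d dvd n \<and> squarefree d}" by simp
  qed simp
  also have "\<dots> = (\<Prod>p\<in>prime_factors n. (- 1) + (1 :: real))"
    by (subst prod_add) simp_all
  also have "\<dots> = of_bool (n = 1)"
    using assms by (cases "n = 1") (auto simp: prime_factorization_empty_iff power_0_left)
  finally show ?thesis .
qed

text \<open>The range of \<open>d\<close> does not depend on \<open>a\<close> and \<open>b\<close>,
  which allows the later exchange of summations.\<close>

lemma sum_mu_gcd:
  assumes "a \<in> {1..int Q}" "b \<in> {1..int Q}"
  shows "(\<Sum>d = 1..Q. mu d * of_bool (int d dvd a \<and> int d dvd b)) = of_bool (coprime a b)"
proof -
  define g where "g = nat (gcd a b)"
  have g: "g > 0" using assms by (simp add: g_def)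
  have dvd: "d dvd g \<longleftrightarrow> int d dvd a \<and> int d dvd b" for d
    by (simp add: g_def int_dvd_int_iff[symmetric] del: int_dvd_int_iff)
  have "d \<le> Q" if "int d dvd a" for d
    using zdvd_imp_le[OF that] assms by simp
  hence "(\<Sum>d = 1..Q. mu d * of_bool (int d dvd a \<and> int d dvd b)) = (\<Sum>d | d dvd g. mu d)"
    using g assms by (intro sum.mono_neutral_cong_right) (auto simp: dvd Suc_le_eq intro!: Nat.gr0I)
  also have "\<dots> = of_bool (g = 1)" by (rule sum_mu_divisors[OF g])
  also have "g = 1 \<longleftrightarrow> coprime a b" by (auto simp: g_def coprime_iff_gcd_eq_1)
  finally show ?thesis .
qed

lemma sum_dvd_reindex:
  fixes g :: "int \<Rightarrow> real"
  assumes "d \<ge> 1" "n \<ge> 0"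
  shows "(\<Sum>a\<in>{1..d * n}. of_bool (d dvd a) * g a) = (\<Sum>a\<in>{1..n}. g (d * a))"
proof -
  have "(\<Sum>a\<in>{1..d * n}. of_bool (d dvd a) * g a) = (\<Sum>a | a \<in> {1..d * n} \<and> d dvd a. g a)"
    by (intro sum.mono_neutral_cong_right) auto
  also have "\<dots> = (\<Sum>a\<in>{1..n}. g (d * a))"
    using assms
    by (intro sum.reindex_bij_witness[of _ "\<lambda>a. d * a" "\<lambda>a. a div d"])
       (auto simp: zero_less_mult_iff int_one_le_iff_zero_less elim!: dvdE)
  finally show ?thesis .
qed

lemma harm_le: "n \<ge> 1 \<Longrightarrow> harm n \<le> (1 + ln (real n) :: real)"
proof (induction n rule: dec_induct)
  case (step n)
  have "ln (real n / real (Suc n)) \<le> real n / real (Suc n) - 1"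
    using step by (intro ln_le_minus_one) auto
  hence "inverse (real (Suc n)) \<le> ln (real (Suc n)) - ln (real n)"
    using step by (simp add: ln_div field_simps)
  thus ?case using step by (simp add: harm_Suc)
qed (simp add: harm_expand)

text \<open>The term \<open>d = 1\<close> dominates: the others add up to at most
  \<open>3 / 4\<close> by telescoping. The lower bound serves to count Farey fractions, the upper
  one to absorb a main term that is already small.\<close>

lemma sum_mu_square_bounds:
  assumes "Q \<ge> 1"
  shows "(\<Sum>d = 1..Q. mu d / (real d)\<^sup>2) \<ge> 1 / 4" "\<bar>\<Sum>d = 1..Q. mu d / (real d)\<^sup>2\<bar> \<le> 2"
proof -
  have tail: "(\<Sum>d = 2..Q. 1 / (real d)\<^sup>2) \<le> 3 / 4"
  proof -
    have "(\<Sum>d = 2..Q. 1 / (real d)\<^sup>2) \<le> 3 / 4 - 1 / real Q" if "Q \<ge> 2"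
      using that
    proof (induction Q rule: dec_induct)
      case (step n)
      have "1 / (real (Suc n))\<^sup>2 \<le> 1 / real n - 1 / real (Suc n)"
        using step by (simp add: divide_simps power2_eq_square)
      thus ?case using step by simp
    qed simp
    moreover have "3 / 4 - 1 / real Q \<le> 3 / 4" by simp
    ultimately show ?thesis
    proof (cases "Q \<ge> 2")
      case False
      hence "Q = 1" using assms by simp
      thus ?thesis by simp
    qed linarith
  qed
  have "(\<Sum>d = 1..Q. mu d / (real d)\<^sup>2) = 1 + (\<Sum>d = 2..Q. mu d / (real d)\<^sup>2)"
    using assms by (simp add: sum.atLeast_Suc_atMost numeral_2_eq_2)
  moreover have "\<bar>\<Sum>d = 2..Q. mu d / (real d)\<^sup>2\<bar> \<le> (\<Sum>d = 2..Q. 1 / (real d)\<^sup>2)"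
    by (intro order.trans[OF sum_abs] sum_mono) (simp add: divide_right_mono abs_mu_le)
  ultimately show "(\<Sum>d = 1..Q. mu d / (real d)\<^sup>2) \<ge> 1 / 4" "\<bar>\<Sum>d = 1..Q. mu d / (real d)\<^sup>2\<bar> \<le> 2"
    using tail by linarith+
qed

lemma sum_square_extend:
  fixes f :: "int \<Rightarrow> int \<Rightarrow> real"
  assumes "\<And>a b. a > Q \<or> b > Q \<Longrightarrow> f a b = 0" "Q \<le> R"
  shows "(\<Sum>a\<in>{1..R}. \<Sum>b\<in>{1..R}. f a b) = (\<Sum>a\<in>{1..Q}. \<Sum>b\<in>{1..Q}. f a b)"
proof -
  have "(\<Sum>a\<in>{1..R}. \<Sum>b\<in>{1..R}. f a b) = (\<Sum>a\<in>{1..Q}. \<Sum>b\<in>{1..R}. f a b)"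
    using assms by (intro sum.mono_neutral_right ballI sum.neutral) auto
  also have "\<dots> = (\<Sum>a\<in>{1..Q}. \<Sum>b\<in>{1..Q}. f a b)"
    using assms by (intro sum.cong refl sum.mono_neutral_right ballI) auto
  finally show ?thesis .
qed

text \<open>The error for each \<open>d\<close> is \<open>O(Q / d)\<close>, and summing gives the
  harmonic factor. The support condition permits enlarging the square to a multiple of
  \<open>d\<close>, where the mesh comparison applies.\<close>

lemma tame_coprime_sum:
  assumes "tame f" and supp: "\<And>Q a b. a > Q \<or> b > Q \<Longrightarrow> f Q a b = 0"
  obtains C :: real where "C \<ge> 0"
    "\<And>Q :: nat. Q \<ge> 1 \<Longrightarrow>
      \<bar>(\<Sum>a\<in>{1..int Q}. \<Sum>b\<in>{1..int Q}. of_bool (coprime a b) * f (int Q) a b)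
        - (\<Sum>d = 1..Q. mu d / (real d)\<^sup>2) * (\<Sum>a\<in>{1..int Q}. \<Sum>b\<in>{1..int Q}. f (int Q) a b)\<bar>
      \<le> C * real Q * (1 + ln (real Q))"
proof -
  obtain C :: real where C: "C \<ge> 0"
    "\<And>d n Q. d \<ge> 1 \<Longrightarrow> n \<ge> 0 \<Longrightarrow>
      \<bar>(real_of_int d)\<^sup>2 * (\<Sum>a\<in>{1..n}. \<Sum>b\<in>{1..n}. f Q (d * a) (d * b))
        - (\<Sum>a\<in>{1..d * n}. \<Sum>b\<in>{1..d * n}. f Q a b)\<bar> \<le> C * (real_of_int d)\<^sup>2 * real_of_int n"
    using tame_mesh[OF assms(1)] by metis
  show ?thesis
  proof (rule that[of "2 * C"])
    fix Q :: nat assume Q: "Q \<ge> 1"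
    define F where "F = (\<Sum>a\<in>{1..int Q}. \<Sum>b\<in>{1..int Q}. f (int Q) a b)"
    define S where "S d = (\<Sum>a\<in>{1..int Q}. \<Sum>b\<in>{1..int Q}. of_bool (int d dvd a \<and> int d dvd b) * f (int Q) a b)" for d
    have S: "\<bar>S d - F / (real d)\<^sup>2\<bar> \<le> 2 * C * real Q / real d" if d: "d \<in> {1..Q}" for d
    proof -
      \<comment> \<open>Rounded up, so that \<open>d * n\<close> exceeds \<open>Q\<close>; as
        \<open>d \<le> Q\<close>, this costs only the factor 2 in \<open>n'\<close>.\<close>
      define n where "n = int (Q div d + 1)"
      have n: "n \<ge> 0" by (simp add: n_def)
      have "Q < d * (Q div d + 1)" using dividend_less_times_div[of d Q] d by simp
      hence Qn: "int Q \<le> int d * n" unfolding n_def by (metis of_nat_mult of_nat_le_iff less_imp_le)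
      have "real (Q div d) \<le> real Q / real d" by (rule of_nat_div_le_of_nat)
      moreover have "1 \<le> real Q / real d" using d by simp
      ultimately have n': "real_of_int n \<le> 2 * real Q / real d" by (simp add: n_def)
      have F': "F = (\<Sum>a\<in>{1..int d * n}. \<Sum>b\<in>{1..int d * n}. f (int Q) a b)"
        unfolding F_def using supp Qn by (intro sum_square_extend[symmetric]) auto
      have "S d = (\<Sum>a\<in>{1..int d * n}. \<Sum>b\<in>{1..int d * n}. of_bool (int d dvd a \<and> int d dvd b) * f (int Q) a b)"
        unfolding S_def using supp Qn by (intro sum_square_extend[symmetric]) auto
      also have "\<dots> = (\<Sum>a\<in>{1..int d * n}. of_bool (int d dvd a) * (\<Sum>b\<in>{1..int d * n}. of_bool (int d dvd b) * f (int Q) a b))"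
        by (simp only: sum_distrib_left of_bool_conj mult.assoc)
      also have "\<dots> = (\<Sum>a\<in>{1..n}. \<Sum>b\<in>{1..n}. f (int Q) (int d * a) (int d * b))"
        using sum_dvd_reindex[of "int d" n] d n by simp
      finally have "\<bar>(real d)\<^sup>2 * S d - F\<bar> \<le> C * (real d)\<^sup>2 * real_of_int n"
        using C(2)[of "int d" n "int Q"] d n F' by simp
      hence "\<bar>(real d)\<^sup>2 * S d - F\<bar> / (real d)\<^sup>2 \<le> C * (real d)\<^sup>2 * real_of_int n / (real d)\<^sup>2"
        by (intro divide_right_mono) auto
      also have "\<dots> = C * real_of_int n" using d by simp
      also have "\<dots> \<le> C * (2 * real Q / real d)" by (intro mult_left_mono n' C)
      also have "\<bar>(real d)\<^sup>2 * S d - F\<bar> / (real d)\<^sup>2 = \<bar>((real d)\<^sup>2 * S d - F) / (real d)\<^sup>2\<bar>"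
        by simp
      also have "((real d)\<^sup>2 * S d - F) / (real d)\<^sup>2 = S d - F / (real d)\<^sup>2"
        using d by (simp add: diff_divide_distrib)
      finally show ?thesis by (simp add: mult_ac)
    qed
    have "(\<Sum>a\<in>{1..int Q}. \<Sum>b\<in>{1..int Q}. of_bool (coprime a b) * f (int Q) a b) =
      (\<Sum>a\<in>{1..int Q}. \<Sum>b\<in>{1..int Q}. \<Sum>d = 1..Q. mu d * (of_bool (int d dvd a \<and> int d dvd b) * f (int Q) a b))"
      by (intro sum.cong refl) (simp only: sum_mu_gcd[symmetric, where Q = Q] sum_distrib_right mult.assoc)
    also have "\<dots> = (\<Sum>a\<in>{1..int Q}. \<Sum>d = 1..Q. \<Sum>b\<in>{1..int Q}. mu d * (of_bool (int d dvd a \<and> int d dvd b) * f (int Q) a b))"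
      by (intro sum.cong refl sum.swap)
    also have "\<dots> = (\<Sum>d = 1..Q. \<Sum>a\<in>{1..int Q}. \<Sum>b\<in>{1..int Q}. mu d * (of_bool (int d dvd a \<and> int d dvd b) * f (int Q) a b))"
      by (rule sum.swap)
    also have "\<dots> = (\<Sum>d = 1..Q. mu d * S d)"
      by (simp only: S_def sum_distrib_left)
    finally have "(\<Sum>a\<in>{1..int Q}. \<Sum>b\<in>{1..int Q}. of_bool (coprime a b) * f (int Q) a b)
        - (\<Sum>d = 1..Q. mu d / (real d)\<^sup>2) * F = (\<Sum>d = 1..Q. mu d * (S d - F / (real d)\<^sup>2))"
      by (simp add: sum_distrib_right sum_subtractf right_diff_distrib)
    also have "\<bar>\<dots>\<bar> \<le> (\<Sum>d = 1..Q. \<bar>mu d * (S d - F / (real d)\<^sup>2)\<bar>)" by (rule sum_abs)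
    also have "\<dots> \<le> (\<Sum>d = 1..Q. 1 * (2 * C * real Q / real d))"
      unfolding abs_mult by (intro sum_mono mult_mono S abs_mu_le) auto
    also have "\<dots> = 2 * C * real Q * harm Q"
      by (simp add: harm_def sum_distrib_left divide_inverse)
    also have "\<dots> \<le> 2 * C * real Q * (1 + ln (real Q))"
      using C Q by (intro mult_left_mono harm_le) auto
    finally show "\<bar>(\<Sum>a\<in>{1..int Q}. \<Sum>b\<in>{1..int Q}. of_bool (coprime a b) * f (int Q) a b)
        - (\<Sum>d = 1..Q. mu d / (real d)\<^sup>2) * (\<Sum>a\<in>{1..int Q}. \<Sum>b\<in>{1..int Q}. f (int Q) a b)\<bar>
      \<le> 2 * C * real Q * (1 + ln (real Q))" by (simp add: F_def)
  qed (use C in auto)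
qed

section \<open>Neighbouring Farey fractions\<close>

abbreviation denom :: "rat \<Rightarrow> int" where "denom r \<equiv> snd (quotient_of r)"
abbreviation numer :: "rat \<Rightarrow> int" where "numer r \<equiv> fst (quotient_of r)"

lemma quotient_of_divide:
  assumes "coprime a b" "b > 0"
  shows "quotient_of (of_int a / of_int b) = (a, b)"
  using assms by (simp add: Fract_of_int_quotient[symmetric] quotient_of_Fract normalize_def)

lemma rat_eq_numer_denom: "r = of_int (numer r) / of_int (denom r)"
  by (metis Fract_quotient_of Fract_of_int_quotient)

lemma quotient_of_add_int:
  "quotient_of (r + of_int m) = (numer r + m * denom r, denom r)"
proof -
  have pos: "denom r > 0" by (rule quotient_of_denom_pos')
  have "coprime (numer r) (denom r)" by (metis prod.collapse quotient_of_coprime)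
  hence "coprime (numer r + m * denom r) (denom r)"
    by (metis coprime_iff_gcd_eq_1 gcd.commute gcd_add_mult mult.commute add.commute)
  moreover have "r + of_int m = of_int (numer r + m * denom r) / of_int (denom r)"
    using pos by (subst rat_eq_numer_denom[of r]) (simp add: field_simps)
  ultimately show ?thesis using quotient_of_divide pos by metis
qed

section \<open>The Farey sequence as an increasing enumeration of the rationals of bounded
  denominator\<close>

lemma finite_farey: "finite (farey Q)"
proof (rule finite_subset)
  show "farey Q \<subseteq> (\<lambda>(a, b). of_int a / of_int b) ` ({1..int Q} \<times> {1..int Q})"
  proof
    fix r assume r: "r \<in> farey Q"
    define a b where "a = numer r" and "b = denom r"
    have ab: "r = of_int a / of_int b" "b > 0"
      by (simp_all add: a_def b_def rat_eq_numer_denom[symmetric] quotient_of_denom_pos')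
    hence "0 < a" "a \<le> b"
      using r by (auto simp: farey_def zero_less_divide_iff divide_le_eq)
    moreover have "b \<le> int Q" using r by (simp add: farey_def b_def)
    ultimately show "r \<in> (\<lambda>(a, b). of_int a / of_int b) ` ({1..int Q} \<times> {1..int Q})"
      using ab by (intro image_eqI[of _ _ "(a, b)"]) auto
  qed
qed auto

lemma one_in_farey: "Q \<ge> 1 \<Longrightarrow> 1 \<in> farey Q"
  by (simp add: farey_def)

lemma farey_N_pos: "Q \<ge> 1 \<Longrightarrow> farey_N Q > 0"
  unfolding farey_N_def using one_in_farey finite_farey by (metis card_gt_0_iff empty_iff)

lemma farey_gamma_shift:
  assumes "Q \<ge> 1"
  shows "farey_gamma Q (i + m * int (farey_N Q)) = farey_gamma Q i + of_int m"
proof -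
  have "i + m * int (farey_N Q) - 1 = (i - 1) + m * int (farey_N Q)" by simp
  thus ?thesis
    using farey_N_pos[OF assms] unfolding farey_gamma_def Let_def by (simp only:) simp
qed

lemma farey_gamma_nth:
  assumes "n < farey_N Q"
  shows "farey_gamma Q (int n + 1) = sorted_list_of_set (farey Q) ! n"
  using assms by (simp add: farey_gamma_def)

lemma farey_gamma_mem:
  assumes "n < farey_N Q"
  shows "farey_gamma Q (int n + 1) \<in> farey Q"
proof -
  have "sorted_list_of_set (farey Q) ! n \<in> set (sorted_list_of_set (farey Q))"
    using assms by (intro nth_mem) (simp add: farey_N_def)
  thus ?thesis using assms finite_farey by (simp add: farey_gamma_nth)
qed

lemma farey_index_decomp:
  assumes "Q \<ge> 1"
  obtains n m where "n < farey_N Q" "i = int n + 1 + m * int (farey_N Q)"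
proof (rule that[of "nat ((i - 1) mod int (farey_N Q))" "(i - 1) div int (farey_N Q)"])
  have N: "int (farey_N Q) > 0" using farey_N_pos[OF assms] by simp
  show "nat ((i - 1) mod int (farey_N Q)) < farey_N Q"
    using N by (simp add: nat_less_iff)
  show "i = int (nat ((i - 1) mod int (farey_N Q))) + 1 + (i - 1) div int (farey_N Q) * int (farey_N Q)"
    using N by (simp add: algebra_simps)
qed

lemma farey_gamma_less_Suc:
  assumes "Q \<ge> 1"
  shows "farey_gamma Q i < farey_gamma Q (i + 1)"
proof -
  obtain n m where nm: "n < farey_N Q" "i = int n + 1 + m * int (farey_N Q)"
    by (rule farey_index_decomp[OF assms])
  have i: "farey_gamma Q i = farey_gamma Q (int n + 1) + of_int m"
    unfolding nm(2) by (rule farey_gamma_shift[OF assms])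
  show ?thesis
  proof (cases "n + 1 < farey_N Q")
    case True
    have "i + 1 = int (n + 1) + 1 + m * int (farey_N Q)" using nm by simp
    hence "farey_gamma Q (i + 1) = farey_gamma Q (int (n + 1) + 1) + of_int m"
      using farey_gamma_shift[OF assms] by metis
    moreover have "sorted_list_of_set (farey Q) ! n < sorted_list_of_set (farey Q) ! (n + 1)"
      using True by (intro sorted_wrt_nth_less[of "(<)"]) (auto simp: farey_N_def)
    ultimately show ?thesis using i nm True by (simp only: farey_gamma_nth)
  next
    case False
    hence "i + 1 = int 0 + 1 + (m + 1) * int (farey_N Q)" using nm by (simp add: algebra_simps)
    hence "farey_gamma Q (i + 1) = farey_gamma Q (int 0 + 1) + of_int (m + 1)"
      using farey_gamma_shift[OF assms] by metis
    moreover have "farey_gamma Q (int 0 + 1) > 0" "farey_gamma Q (int n + 1) \<le> 1"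
      using farey_gamma_mem[of 0] farey_gamma_mem[of n] nm farey_N_pos[OF assms]
      by (auto simp: farey_def)
    ultimately show ?thesis using i by simp
  qed
qed

lemma farey_gamma_less_iff:
  assumes "Q \<ge> 1"
  shows "farey_gamma Q i < farey_gamma Q j \<longleftrightarrow> i < j"
proof -
  have *: "farey_gamma Q i < farey_gamma Q j" if "i < j" for i j
    using that
  proof (induction j rule: int_gr_induct)
    case base thus ?case by (rule farey_gamma_less_Suc[OF assms])
  next
    case (step j) thus ?case using farey_gamma_less_Suc[OF assms, of j] by (blast intro: less_trans)
  qed
  show ?thesis using *[of i j] *[of j i] by (metis less_asym linorder_cases order_less_irrefl)
qed

lemma farey_gamma_eq_iff:
  assumes "Q \<ge> 1"
  shows "farey_gamma Q i = farey_gamma Q j \<longleftrightarrow> i = j"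
  using farey_gamma_less_iff[OF assms] by (metis less_irrefl linorder_neqE)

lemma range_farey_gamma:
  assumes "Q \<ge> 1"
  shows "range (farey_gamma Q) = {r. denom r \<le> int Q}"
proof (intro equalityI subsetI)
  fix r assume "r \<in> range (farey_gamma Q)"
  then obtain i where i: "r = farey_gamma Q i" by blast
  obtain n m where nm: "n < farey_N Q" "i = int n + 1 + m * int (farey_N Q)"
    by (rule farey_index_decomp[OF assms])
  have "r = farey_gamma Q (int n + 1) + of_int m"
    unfolding i nm(2) by (rule farey_gamma_shift[OF assms])
  thus "r \<in> {r. denom r \<le> int Q}"
    using farey_gamma_mem[OF nm(1)] by (simp add: quotient_of_add_int farey_def)
next
  fix r assume r: "r \<in> {r. denom r \<le> int Q}"
  \<comment> \<open>The representatives lie in the half-open interval from 0 (excluded) to 1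
    (included), hence the ceiling minus 1 instead of the floor.\<close>
  define m where "m = \<lceil>r\<rceil> - 1"
  have "r + of_int (- m) \<in> farey Q"
    using r unfolding farey_def quotient_of_add_int mem_Collect_eq by (simp add: m_def) linarith
  then obtain n where n: "n < farey_N Q" "sorted_list_of_set (farey Q) ! n = r + of_int (- m)"
    by (metis farey_N_def finite_farey in_set_conv_nth length_sorted_list_of_set set_sorted_list_of_set)
  hence "farey_gamma Q (int n + 1 + m * int (farey_N Q)) = r"
    by (simp add: farey_gamma_shift[OF assms] farey_gamma_nth)
  thus "r \<in> range (farey_gamma Q)" by blast
qed

lemma farey_q_pos: "farey_q Q i > 0"
  by (simp add: farey_q_def quotient_of_denom_pos')

lemma farey_q_le: "Q \<ge> 1 \<Longrightarrow> farey_q Q i \<le> int Q"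
  using range_farey_gamma by (fastforce simp: farey_q_def)

lemma farey_coprime: "coprime (farey_p Q i) (farey_q Q i)"
  unfolding farey_p_def farey_q_def by (metis prod.collapse quotient_of_coprime)

lemma farey_gamma_quotient: "farey_gamma Q i = of_int (farey_p Q i) / of_int (farey_q Q i)"
  unfolding farey_p_def farey_q_def by (rule rat_eq_numer_denom)

lemma farey_q_shift: "Q \<ge> 1 \<Longrightarrow> farey_q Q (i + m * int (farey_N Q)) = farey_q Q i"
  by (simp add: farey_q_def farey_gamma_shift quotient_of_add_int)

text \<open>A fraction strictly between \<open>p / q\<close> and \<open>p' / q'\<close> with
  determinant 1 has denominator at least \<open>q + q'\<close>, which exceeds
  \<open>Q\<close>.\<close>

lemma farey_gamma_next:
  assumes Q: "Q \<ge> 1" and i: "farey_p Q i = p" "farey_q Q i = q"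
    and det: "p' * q - p * q' = 1" and q': "int Q - q < q'" "q' \<le> int Q" "q' > 0"
  shows "farey_p Q (i + 1) = p'" "farey_q Q (i + 1) = q'"
proof -
  have q: "q > 0" using farey_q_pos i by auto
  define r where "r = (of_int p' / of_int q' :: rat)"
  have "coprime p' q'"
  proof (rule coprimeI)
    fix c assume "c dvd p'" "c dvd q'"
    hence "c dvd p' * q - p * q'" by simp
    thus "is_unit c" using det by simp
  qed
  hence r: "quotient_of r = (p', q')" unfolding r_def using q' by (intro quotient_of_divide)
  then obtain j where j: "r = farey_gamma Q j"
    using range_farey_gamma[OF Q] q' by (metis (mono_tags, lifting) UNIV_I imageE mem_Collect_eq snd_conv)
  have "of_int (p' * q - p * q') = (1 :: rat)" using det by simp
  hence "farey_gamma Q i < r"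
    using q q' by (simp add: r_def farey_gamma_quotient i field_simps)
  hence "i < j" using farey_gamma_less_iff[OF Q] j by simp
  moreover have False if "i + 1 < j"
  proof -
    define s t where "s = farey_p Q (i + 1)" and "t = farey_q Q (i + 1)"
    have t: "t > 0" "t \<le> int Q" using farey_q_pos farey_q_le[OF Q] by (auto simp: t_def)
    have st: "farey_gamma Q (i + 1) = of_int s / of_int t"
      by (simp add: s_def t_def farey_gamma_quotient)
    have "of_int p / of_int q < (of_int s / of_int t :: rat)"
      using farey_gamma_less_Suc[OF Q, of i] st farey_gamma_quotient[of Q i] i by simp
    hence "of_int (p * t) < (of_int (s * q) :: rat)" using q t by (simp add: field_simps)
    hence 1: "s * q - p * t \<ge> 1" by (simp only: of_int_less_iff)
    have "of_int s / of_int t < (of_int p' / of_int q' :: rat)"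
      using farey_gamma_less_iff[OF Q, of "i + 1" j] that st j by (simp add: r_def)
    hence "of_int (s * q') < (of_int (p' * t) :: rat)" using q' t by (simp add: field_simps)
    hence 2: "p' * t - s * q' \<ge> 1" by (simp only: of_int_less_iff)
    have "t = t * (p' * q - p * q')" using det by simp
    also have "\<dots> = q * (p' * t - s * q') + q' * (s * q - p * t)" by (simp add: algebra_simps)
    also have "\<dots> \<ge> q * 1 + q' * 1" using 1 2 q q' by (intro add_mono mult_left_mono) auto
    finally show False using t q' by simp
  qed
  ultimately have "j = i + 1" by force
  thus "farey_p Q (i + 1) = p'" "farey_q Q (i + 1) = q'"
    using r j by (simp_all add: farey_p_def farey_q_def)
qed

text \<open>The admissible \<open>q'\<close> fill a residue class modulo \<open>q\<close>, which
  meets every window of length \<open>q\<close>. The window ending at \<open>Q\<close> is the one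
  that yields the Farey successor.\<close>

lemma bezout_window:
  fixes p q Q :: int
  assumes "coprime p q" "q > 0"
  obtains p' q' where "p' * q - p * q' = 1" "Q - q < q'" "q' \<le> Q"
proof -
  obtain u v where uv: "u * p + v * q = 1"
    using bezout_int[of p q] assms by (metis coprime_iff_gcd_eq_1)
  define k where "k = (Q + u) div q"
  have "(Q + u) - q * k = (Q + u) mod q" by (simp add: k_def minus_mult_div_eq_mod)
  hence "0 \<le> (Q + u) - q * k" "(Q + u) - q * k < q" using assms by auto
  moreover have "(v + k * p) * q - p * (k * q - u) = 1" using uv by (simp add: algebra_simps)
  ultimately show ?thesis by (intro that[of "v + k * p" "k * q - u"]) (auto simp: algebra_simps)
qed

lemma farey_neighbours:
  assumes "Q \<ge> 1"
  shows "farey_p Q (i + 1) * farey_q Q i - farey_p Q i * farey_q Q (i + 1) = 1"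
    and "farey_q Q i + farey_q Q (i + 1) > int Q"
proof -
  obtain p' q' where pq: "p' * farey_q Q i - farey_p Q i * q' = 1" "int Q - farey_q Q i < q'" "q' \<le> int Q"
    using bezout_window[OF farey_coprime farey_q_pos] by metis
  moreover have "q' > 0" using pq farey_q_le[OF assms, of i] by simp
  ultimately have "farey_p Q (i + 1) = p'" "farey_q Q (i + 1) = q'"
    using farey_gamma_next[OF assms refl refl] by auto
  thus "farey_p Q (i + 1) * farey_q Q i - farey_p Q i * farey_q Q (i + 1) = 1"
    and "farey_q Q i + farey_q Q (i + 1) > int Q" using pq by auto
qed

section \<open>Neighbouring denominators as coprime points of a triangle\<close>

definition farey_pairs :: "int \<Rightarrow> (int \<times> int) set" where
  "farey_pairs Q = {(a, b) \<in> {1..Q} \<times> {1..Q}. a + b > Q \<and> coprime a b}"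

lemma finite_farey_pairs: "finite (farey_pairs Q)"
  by (rule finite_subset[of _ "{1..Q} \<times> {1..Q}"]) (auto simp: farey_pairs_def)

text \<open>Injectivity: with equal denominators, the unit determinants force two fractions to
  differ by an integer, which is 0 within a period. Surjectivity: if
  \<open>u * a + v * b = 1\<close>, then \<open>u / b\<close> is the successor of
  \<open>- v / a\<close>.\<close>

lemma bij_betw_farey_pairs:
  assumes Q: "Q \<ge> 1"
  shows "bij_betw (\<lambda>i. (farey_q Q (i - 1), farey_q Q i)) {1..int (farey_N Q)} (farey_pairs (int Q))"
  unfolding bij_betw_def
proof
  define N where "N = int (farey_N Q)"
  have N: "N > 0" using farey_N_pos[OF Q] by (simp add: N_def)
  have det: "farey_p Q i * farey_q Q (i - 1) - farey_p Q (i - 1) * farey_q Q i = 1" for i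
    using farey_neighbours(1)[OF Q, of "i - 1"] by simp
  have cop: "coprime (farey_q Q (i - 1)) (farey_q Q i)" for i
  proof (rule coprimeI)
    fix c assume "c dvd farey_q Q (i - 1)" "c dvd farey_q Q i"
    hence "c dvd farey_p Q i * farey_q Q (i - 1) - farey_p Q (i - 1) * farey_q Q i" by simp
    thus "is_unit c" using det by simp
  qed
  show "inj_on (\<lambda>i. (farey_q Q (i - 1), farey_q Q i)) {1..int (farey_N Q)}"
  proof (rule inj_onI)
    fix i j assume ij: "i \<in> {1..int (farey_N Q)}" "j \<in> {1..int (farey_N Q)}"
      and "(farey_q Q (i - 1), farey_q Q i) = (farey_q Q (j - 1), farey_q Q j)"
    hence eq: "farey_q Q (i - 1) = farey_q Q (j - 1)" "farey_q Q i = farey_q Q j" by auto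
    have "(farey_p Q i - farey_p Q j) * farey_q Q (i - 1) = (farey_p Q (i - 1) - farey_p Q (j - 1)) * farey_q Q i"
      using det[of i] det[of j] eq by (simp add: algebra_simps)
    hence "farey_q Q i dvd (farey_p Q i - farey_p Q j) * farey_q Q (i - 1)" by simp
    hence "farey_q Q i dvd farey_p Q i - farey_p Q j"
      using cop[of i] by (simp add: coprime_dvd_mult_left_iff coprime_commute)
    then obtain m where "farey_p Q i - farey_p Q j = farey_q Q i * m" by (elim dvdE)
    hence m: "farey_p Q i = farey_p Q j + m * farey_q Q j" using eq by (simp add: algebra_simps)
    have "farey_gamma Q i = farey_gamma Q j + of_int m"
      using farey_q_pos[of Q j] unfolding farey_gamma_quotient m eq by (simp add: field_simps)
    hence "i = j + m * N" using farey_gamma_shift[OF Q] farey_gamma_eq_iff[OF Q] by (metis N_def)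
    moreover from this have "\<bar>m * N\<bar> < 1 * N" using ij by (auto simp: N_def)
    hence "\<bar>m\<bar> < 1" using N by (simp only: abs_mult mult_less_cancel_right) auto
    ultimately show "i = j" by simp
  qed
  show "(\<lambda>i. (farey_q Q (i - 1), farey_q Q i)) ` {1..int (farey_N Q)} = farey_pairs (int Q)"
  proof (intro equalityI subsetI)
    fix x assume "x \<in> (\<lambda>i. (farey_q Q (i - 1), farey_q Q i)) ` {1..int (farey_N Q)}"
    thus "x \<in> farey_pairs (int Q)"
      using cop farey_q_pos[of Q] farey_q_le[OF Q] farey_neighbours(2)[OF Q]
      by (auto simp: farey_pairs_def int_one_le_iff_zero_less) (metis diff_add_cancel)
  next
    fix x assume "x \<in> farey_pairs (int Q)"
    then obtain a b where x: "x = (a, b)" and ab: "1 \<le> a" "a \<le> int Q" "1 \<le> b" "b \<le> int Q" "a + b > int Q" "coprime a b"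
      by (auto simp: farey_pairs_def)
    obtain u v where uv: "u * a + v * b = 1"
      using bezout_int[of a b] ab by (metis coprime_iff_gcd_eq_1)
    have "coprime (- v) a"
    proof (rule coprimeI)
      fix c assume "c dvd - v" "c dvd a"
      hence "c dvd u * a + v * b" by simp
      thus "is_unit c" using uv by simp
    qed
    hence quot: "quotient_of (of_int (- v) / of_int a) = (- v, a)"
      using ab by (intro quotient_of_divide) auto
    then obtain i where "farey_gamma Q i = of_int (- v) / of_int a"
      using range_farey_gamma[OF Q] ab by (metis (mono_tags, lifting) UNIV_I imageE mem_Collect_eq snd_conv)
    hence i: "farey_p Q i = - v" "farey_q Q i = a"
      unfolding farey_p_def farey_q_def using quot by simp_all
    have "farey_q Q (i + 1) = b"
      using ab uv by (intro farey_gamma_next(2)[OF Q i, of u]) (auto simp: algebra_simps)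
    \<comment> \<open>\<open>j\<close> is the index \<open>i + 1\<close> of the second denominator,
      reduced to the period from 1 to \<open>N\<close>.\<close>
    define j where "j = (i mod N) + 1"
    have j: "j \<in> {1..N}" using N by (simp add: j_def add1_zle_eq)
    have "i + 1 = j + (i div N) * N" "i = (j - 1) + (i div N) * N" by (simp_all add: j_def)
    hence "farey_q Q j = b" "farey_q Q (j - 1) = a"
      using \<open>farey_q Q (i + 1) = b\<close> i farey_q_shift[OF Q] by (metis N_def)+
    thus "x \<in> (\<lambda>i. (farey_q Q (i - 1), farey_q Q i)) ` {1..int (farey_N Q)}"
      using j x by (auto simp: N_def)
  qed
qed

section \<open>Hall--Shiu identity and large 2-indices\<close>

text \<open>By the recurrence \<open>q (i + 1) + q (i - 1) = k_index Q 2 i * q i\<close>, the sum of the 2-indices is a sum of \<open>a / b + b / a\<close> over the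
  pairs of neighbouring denominators. Going from \<open>m - 1\<close> to \<open>m\<close>, the pairs \<open>(a, m - a)\<close> are replaced by \<open>(a, m)\<close> and \<open>(m, a)\<close>, and
  the change of the sum of \<open>a / b + b / a - 3\<close> is odd under \<open>a \<mapsto> m - a\<close>.\<close>

lemma hall_shiu:
  assumes "n \<ge> 1"
  shows "(\<Sum>(a, b)\<in>farey_pairs n. real_of_int a / real_of_int b + real_of_int b / real_of_int a)
    = 3 * real (card (farey_pairs n)) - 1"
proof -
  define f :: "int \<times> int \<Rightarrow> real" where "f = (\<lambda>(a, b). a / b + b / a - 3)"
  have "sum f (farey_pairs n) = - 1"
    using assms
  proof (induction n rule: int_ge_induct)
    case base
    have "farey_pairs 1 = {(1, 1)}" by (auto simp: farey_pairs_def)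
    thus ?case by (simp add: f_def)
  next
    case (step n)
    define m where "m = n + 1"
    have m: "m > 1" using step by (simp add: m_def)
    define R where "R = {a \<in> {1..<m}. coprime a m}"
    have finR: "finite R" by (rule finite_subset[of _ "{1..<m}"]) (auto simp: R_def)
    have cop: "coprime a (m - a) \<longleftrightarrow> coprime a m" "coprime (m - a) m \<longleftrightarrow> coprime a m" for a
      by (simp_all add: coprime_iff_gcd_eq_1 gcd_diff1 gcd_diff2 gcd.commute[of a])
    define D where "D = (\<lambda>a. (a, m - a)) ` R"
    define U where "U = (\<lambda>a. (a, m)) ` R"
    define V where "V = (\<lambda>a. (m, a)) ` R"
    have nm: "\<not> coprime m m" using m by simp
    \<comment> \<open>Stated with unions on both sides: \<open>D\<close> holds the pairs with
      \<open>a + b = m\<close> that drop out, \<open>U\<close> and \<open>V\<close> the new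
      ones.\<close>
    have "farey_pairs m \<union> D = farey_pairs n \<union> U \<union> V"
    proof (intro equalityI subsetI)
      fix x assume "x \<in> farey_pairs m \<union> D"
      moreover obtain a b where x: "x = (a, b)" by force
      ultimately consider "(a, b) \<in> farey_pairs m" "a < m" "b < m" | "(a, b) \<in> farey_pairs m" "a = m" "b < m"
        | "(a, b) \<in> farey_pairs m" "b = m" "a < m" | "(a, b) \<in> D"
        by (cases "a = m"; cases "b = m") (use nm in \<open>auto simp: farey_pairs_def\<close>)
      thus "x \<in> farey_pairs n \<union> U \<union> V"
      proof cases
        case 4
        thus ?thesis using cop by (auto simp: x D_def R_def farey_pairs_def m_def)
      qed (auto simp: x farey_pairs_def U_def V_def R_def m_def coprime_commute)
    next
      fix x assume "x \<in> farey_pairs n \<union> U \<union> V"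
      moreover obtain a b where x: "x = (a, b)" by force
      moreover have "a + b > m \<or> b = m - a" if "(a, b) \<in> farey_pairs n"
        using that by (auto simp: farey_pairs_def m_def)
      ultimately consider "(a, b) \<in> farey_pairs n" "a + b > m" | "(a, b) \<in> farey_pairs n" "b = m - a"
        | "(a, b) \<in> U" | "(a, b) \<in> V"
        by blast
      thus "x \<in> farey_pairs m \<union> D"
      proof cases
        case 2
        hence "a \<in> R" using cop by (auto simp: farey_pairs_def R_def m_def)
        thus ?thesis using 2 by (auto simp: x D_def)
      qed (auto simp: x farey_pairs_def U_def V_def R_def m_def coprime_commute)
    qed
    moreover have "farey_pairs m \<inter> D = {}" by (auto simp: farey_pairs_def D_def)
    moreover have "farey_pairs n \<inter> U = {}" "(farey_pairs n \<union> U) \<inter> V = {}"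
      by (auto simp: farey_pairs_def U_def V_def R_def m_def)
    moreover have "finite D" "finite U" "finite V" using finR by (simp_all add: D_def U_def V_def)
    ultimately have "sum f (farey_pairs m) + sum f D = sum f (farey_pairs n) + sum f U + sum f V"
      using finite_farey_pairs by (metis finite_UnI sum.union_disjoint)
    moreover have "sum f U + sum f V - sum f D = 0"
    proof -
      \<comment> \<open>Two new pairs and one old pair leave a net constant \<open>- 3\<close>,
        exactly what makes \<open>h\<close> odd under \<open>a \<mapsto> m - a\<close>.\<close>
      define h where "h a = f (a, m) + f (m, a) - f (a, m - a)" for a
      have "sum f U + sum f V - sum f D = sum h R"
        by (simp add: U_def V_def D_def h_def sum.reindex inj_on_def sum.distrib sum_subtractf)
      moreover have "sum h R = (\<Sum>a\<in>R. h (m - a))"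
        using cop by (intro sum.reindex_bij_witness[of _ "\<lambda>a. m - a" "\<lambda>a. m - a"])
          (auto simp: R_def)
      moreover have "sum h R + (\<Sum>a\<in>R. h (m - a)) = (\<Sum>a\<in>R. 0)"
        unfolding sum.distrib[symmetric]
      proof (intro sum.cong refl)
        fix a assume "a \<in> R"
        hence a: "real_of_int a > 0" "real_of_int m - real_of_int a > 0" "real_of_int m > 0"
          using m by (auto simp: R_def)
        have "real_of_int a / (m - a) = m / (m - a) - 1" "real_of_int (m - a) / a = m / a - 1"
          "real_of_int (m - a) / m = 1 - a / m"
          using a by (simp_all add: field_simps)
        thus "h a + h (m - a) = 0" by (simp add: h_def f_def)
      qed
      ultimately show ?thesis by simp
    qed
    ultimately show ?case using step.IH by (simp add: m_def)
  qed
  moreover have "sum f (farey_pairs n) = (\<Sum>(a, b)\<in>farey_pairs n. real_of_int a / real_of_int b + real_of_int b / real_of_int a)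
     - 3 * real (card (farey_pairs n))"
    by (simp add: f_def case_prod_unfold sum_subtractf)
  ultimately show ?thesis by linarith
qed

text \<open>In a sequence with \<open>q (i + 1) + q (i - 1) = j i * q i\<close> a small \<open>q t\<close> (that is, a large \<open>j t\<close>) forces the
  following \<open>j\<close>'s to be 1, 2, 2, 2, \<dots>.\<close>

lemma after_small_denominator:
  fixes q p j :: "int \<Rightarrow> int" and k m t Q :: int
  assumes q: "\<And>i. q (i + 1) + q (i - 1) = j i * q i" and p: "\<And>i. p (i + 1) + p (i - 1) = j i * p i"
    and pos: "\<And>i. q i > 0" and le: "\<And>i. q i \<le> Q" and window: "\<And>i. q i + q (i + 1) > Q"
    and small: "(2 * k + 1) * q t \<le> Q" and m: "1 \<le> m" "m < k"
  shows "j (t + m) = (if m = 1 then 1 else 2)"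
    and "q (t + m) = q (t + 1) - (m - 1) * q t" "p (t + m) = p (t + 1) - (m - 1) * p t"
    and "q (t + m + 1) = q (t + 1) - m * q t" "p (t + m + 1) = p (t + 1) - m * p t"
proof -
  have sm: "(2 * m + 1) * q t \<le> Q" if "m \<le> k" for m
    using mult_right_mono[of "2 * m + 1" "2 * k + 1" "q t"] that small pos[of t] by linarith
  have "m < k \<Longrightarrow> j (t + m) = (if m = 1 then 1 else 2) \<and>
      q (t + m) = q (t + 1) - (m - 1) * q t \<and> p (t + m) = p (t + 1) - (m - 1) * p t \<and>
      q (t + m + 1) = q (t + 1) - m * q t \<and> p (t + m + 1) = p (t + 1) - m * p t"
    using m(1)
  proof (induction m rule: int_ge_induct)
    case base
    have e: "q (t + 2) + q t = j (t + 1) * q (t + 1)" "p (t + 2) + p t = j (t + 1) * p (t + 1)"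
      using q[of "t + 1"] p[of "t + 1"] by (simp_all add: add.assoc)
    have "3 * q t \<le> Q" using sm[of 1] base by simp
    have "j (t + 1) * q (t + 1) > 0" using e(1) pos[of "t + 2"] pos[of t] by simp
    hence "j (t + 1) \<ge> 1" using pos[of "t + 1"] by (simp add: zero_less_mult_iff)
    moreover have "j (t + 1) < 2"
    proof (rule ccontr)
      assume "\<not> j (t + 1) < 2"
      hence "2 * q (t + 1) \<le> j (t + 1) * q (t + 1)" using pos[of "t + 1"] by (intro mult_right_mono) auto
      thus False using e(1) \<open>3 * q t \<le> Q\<close> window[of t] le[of "t + 2"] by linarith
    qed
    ultimately have "j (t + 1) = 1" by simp
    thus ?case using e by (simp add: add.assoc)
  next
    case (step m)
    have IH: "q (t + m) = q (t + 1) - (m - 1) * q t" "p (t + m) = p (t + 1) - (m - 1) * p t"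
      "q (t + m + 1) = q (t + 1) - m * q t" "p (t + m + 1) = p (t + 1) - m * p t"
      using step by auto
    define y where "y = q (t + m + 1)"
    define c where "c = j (t + m + 1)"
    have e: "q (t + m + 2) + q (t + m) = c * y" "p (t + m + 2) + p (t + m) = c * p (t + m + 1)"
      using q[of "t + m + 1"] p[of "t + m + 1"] by (simp_all add: add.assoc y_def c_def)
    have qm: "q (t + m) = y + q t" "y = q (t + 1) - m * q t" using IH by (simp_all add: y_def algebra_simps)
    have y: "y > 0" "y \<le> Q" "q (t + m + 2) > Q - y" "q (t + m + 2) \<le> Q"
      using pos le window[of "t + m + 1"] by (simp_all add: y_def add.assoc)
    have big: "(2 * m + 3) * q t \<le> Q" using sm[of "m + 1"] step by (simp add: algebra_simps)
    have "c > 1"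
    proof (rule ccontr)
      assume "\<not> c > 1"
      hence "c * y \<le> 1 * y" using y by (intro mult_right_mono) auto
      thus False using e(1) y qm pos[of t] by linarith
    qed
    moreover have "c < 3"
    proof (rule ccontr)
      assume "\<not> c < 3"
      hence "3 * y \<le> c * y" using y by (intro mult_right_mono) auto
      hence "2 * q (t + 1) - (2 * m + 1) * q t \<le> Q" using e(1) y(4) qm by (simp add: algebra_simps)
      moreover have "(2 * m + 3) * q t = (2 * m + 1) * q t + 2 * q t" by (simp add: algebra_simps)
      ultimately show False using big window[of t] by linarith
    qed
    ultimately have c: "c = 2" by simp
    hence "q (t + m + 2) = q (t + 1) - (m + 1) * q t" "p (t + m + 2) = p (t + 1) - (m + 1) * p t"
      using e IH by (simp_all add: y_def algebra_simps)
    moreover have assoc: "t + (m + 1) = t + m + 1" "t + m + 1 + 1 = t + m + 2" by simp_all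
    ultimately show ?case using IH c step.hyps unfolding assoc by (simp add: c_def)
  qed
  thus "j (t + m) = (if m = 1 then 1 else 2)"
    and "q (t + m) = q (t + 1) - (m - 1) * q t" "p (t + m) = p (t + 1) - (m - 1) * p t"
    and "q (t + m + 1) = q (t + 1) - m * q t" "p (t + m + 1) = p (t + 1) - m * p t"
    using m by auto
qed

text \<open>Freeing both ends of the \<open>k\<close>-index exposes the three-term recurrence in
  \<open>n\<close> for fixed \<open>m\<close>.\<close>

definition farey_det :: "nat \<Rightarrow> int \<Rightarrow> int \<Rightarrow> int" where
  "farey_det Q m n = farey_p Q n * farey_q Q m - farey_p Q m * farey_q Q n"

lemma k_index_eq_det: "k_index Q k i = farey_det Q (i - 1) (i - 1 + int k)"
  by (simp add: k_index_def farey_det_def algebra_simps)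

lemma two_index_eq_det: "k_index Q 2 i = farey_det Q (i - 1) (i + 1)"
  by (simp add: k_index_eq_det add.commute)

text \<open>The vector sum of the two neighbours of \<open>(p i, q i)\<close> has determinant
  \<open>1 - 1 = 0\<close> with it, hence is a multiple of it; the multiplier is the
  2-index.\<close>

lemma farey_recurrence:
  assumes "Q \<ge> 1"
  shows "farey_q Q (i + 1) + farey_q Q (i - 1) = k_index Q 2 i * farey_q Q i"
    and "farey_p Q (i + 1) + farey_p Q (i - 1) = k_index Q 2 i * farey_p Q i"
proof -
  have "farey_p Q (i + 1) * farey_q Q i - farey_p Q i * farey_q Q (i + 1) = 1"
    "farey_p Q i * farey_q Q (i - 1) - farey_p Q (i - 1) * farey_q Q i = 1"
    using farey_neighbours(1)[OF assms, of i] farey_neighbours(1)[OF assms, of "i - 1"] by simp_all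
  thus "farey_q Q (i + 1) + farey_q Q (i - 1) = k_index Q 2 i * farey_q Q i"
    and "farey_p Q (i + 1) + farey_p Q (i - 1) = k_index Q 2 i * farey_p Q i"
    unfolding two_index_eq_det farey_det_def by algebra+
qed

lemma two_index_pos:
  assumes "Q \<ge> 1"
  shows "k_index Q 2 i \<ge> 1"
proof -
  have "k_index Q 2 i * farey_q Q i > 0"
    using farey_recurrence(1)[OF assms, of i] farey_q_pos[of Q "i + 1"] farey_q_pos[of Q "i - 1"] by simp
  thus ?thesis using farey_q_pos[of Q i] by (simp add: zero_less_mult_iff)
qed

lemma farey_det_step:
  assumes "Q \<ge> 1"
  shows "farey_det Q e (i + 1) = k_index Q 2 i * farey_det Q e i - farey_det Q e (i - 1)"
proof -
  have "farey_q Q (i + 1) = k_index Q 2 i * farey_q Q i - farey_q Q (i - 1)"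
    "farey_p Q (i + 1) = k_index Q 2 i * farey_p Q i - farey_p Q (i - 1)"
    using farey_recurrence[OF assms, of i] by simp_all
  thus ?thesis unfolding farey_det_def by algebra
qed

text \<open>On both sides of \<open>t\<close> the vectors \<open>(p, q)\<close> form arithmetic
  progressions with difference minus the vector at \<open>t\<close>. Expanding the determinant gives
  \<open>j t - (m - 1) - (s - 1)\<close>.\<close>

lemma big_two_index:
  fixes k :: nat
  assumes Q: "Q \<ge> 1" and big: "k_index Q 2 t > 4 * int k + 2" and s: "1 \<le> s" "1 \<le> m" "s + m = int k"
  shows "farey_det Q (t - s) (t + m) = k_index Q 2 t - int k + 2"
    and "t - s < i \<Longrightarrow> i < t + m \<Longrightarrow> i \<noteq> t \<Longrightarrow> k_index Q 2 i \<le> 2"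
proof -
  let ?q = "farey_q Q" and ?p = "farey_p Q" and ?j = "k_index Q 2"
  \<comment> \<open>Origin of the threshold: \<open>j t \<ge> 4 * k + 3\<close> together with
    \<open>q (t + 1) + q (t - 1) \<le> 2 * Q\<close> yields
    \<open>(2 * k + 1) * q t \<le> Q\<close>.\<close>
  have "(4 * int k + 3) * ?q t \<le> ?j t * ?q t" using big farey_q_pos[of Q t] by (intro mult_right_mono) auto
  also have "\<dots> \<le> 2 * int Q"
    using farey_recurrence(1)[OF Q, of t] farey_q_le[OF Q, of "t + 1"] farey_q_le[OF Q, of "t - 1"] by simp
  finally have small: "(2 * int k + 1) * ?q t \<le> int Q"
    using farey_q_pos[of Q t] by (simp add: algebra_simps)
  note fw = after_small_denominator[of ?q ?j ?p "int Q" "int k" t, OF farey_recurrence[OF Q] farey_q_pos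
      farey_q_le[OF Q] farey_neighbours(2)[OF Q] small]
  \<comment> \<open>Reversing the sequence preserves the recurrence and the window condition, and
    \<open>after_small_denominator\<close> assumes no determinant relation, so it also describes
    what precedes \<open>t\<close>.\<close>
  have neg: "- (i + 1) = - i - 1" "- (i - 1) = - i + 1" for i :: int by simp_all
  have "?q (- (i + 1)) + ?q (- (i - 1)) = ?j (- i) * ?q (- i)"
    "?p (- (i + 1)) + ?p (- (i - 1)) = ?j (- i) * ?p (- i)" for i
    unfolding neg using farey_recurrence[OF Q, of "- i"] by (simp_all only: add.commute)
  moreover have "?q (- i) + ?q (- (i + 1)) > int Q" for i
    unfolding neg using farey_neighbours(2)[OF Q, of "- i - 1"] by (simp add: add.commute)
  moreover have "(2 * int k + 1) * ?q (- (- t)) \<le> int Q" using small by simp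
  ultimately have bw: "1 \<le> m \<Longrightarrow> m < int k \<Longrightarrow> ?j (- (- t + m)) = (if m = 1 then 1 else 2)"
    "1 \<le> m \<Longrightarrow> m < int k \<Longrightarrow> ?q (- (- t + m)) = ?q (- (- t + 1)) - (m - 1) * ?q (- (- t))"
    "1 \<le> m \<Longrightarrow> m < int k \<Longrightarrow> ?p (- (- t + m)) = ?p (- (- t + 1)) - (m - 1) * ?p (- (- t))" for m
    using after_small_denominator(1-3)[of "\<lambda>i. ?q (- i)" "\<lambda>i. ?j (- i)" "\<lambda>i. ?p (- i)" "int Q" "int k" "- t" m]
      farey_q_pos farey_q_le[OF Q] by blast+
  have f: "?q (t + m) = ?q (t + 1) - (m - 1) * ?q t" "?p (t + m) = ?p (t + 1) - (m - 1) * ?p t"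
    using fw(2,3)[of m] s by simp_all
  have b: "?q (t - s) = ?q (t - 1) - (s - 1) * ?q t" "?p (t - s) = ?p (t - 1) - (s - 1) * ?p t"
    using bw(2,3)[of s] s by (simp_all add: algebra_simps)
  have "?p (t + 1) * ?q t - ?p t * ?q (t + 1) = 1" "?p t * ?q (t - 1) - ?p (t - 1) * ?q t = 1"
    using farey_neighbours(1)[OF Q, of t] farey_neighbours(1)[OF Q, of "t - 1"] by simp_all
  moreover have "int k = s + m" using s by simp
  ultimately show "farey_det Q (t - s) (t + m) = ?j t - int k + 2"
    unfolding two_index_eq_det farey_det_def f b by algebra
  show "?j i \<le> 2" if i: "t - s < i" "i < t + m" "i \<noteq> t"
  proof (cases "i > t")
    case True
    thus ?thesis using fw(1)[of "i - t"] i s by (auto split: if_splits)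
  next
    case False
    thus ?thesis using bw(1)[of "t - i"] i s by (auto split: if_splits)
  qed
qed

section \<open>Averaging the k-index\<close>

text \<open>The determinant of \<open>\<gamma>\<^sub>e\<close> and \<open>\<gamma>\<^sub>i\<close> satisfies the recurrence of the denominators, so it can be computed from two
  neighbouring denominators \<open>x, y\<close>. The sum over \<open>s\<close> has at most one nonzero term, \<open>s = \<lfloor>(Q + x) / y\<rfloor>\<close>; writing it this way keeps
  everything a combination of signs of linear forms. The value is 0 as soon as a 2-index exceeds \<open>J\<close>.\<close>

primrec capped_continuant :: "int \<Rightarrow> nat \<Rightarrow> int \<Rightarrow> int \<Rightarrow> int \<Rightarrow> int \<Rightarrow> int \<Rightarrow> real" where
  "capped_continuant J 0 Q x y c d = real_of_int d"
| "capped_continuant J (Suc n) Q x y c d =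
    (\<Sum>s\<in>{0..J}. of_bool (s * y \<le> Q + x) * of_bool (Q + x < (s + 1) * y) *
      capped_continuant J n Q y (s * y - x) d (s * d - c))"

text \<open>The quantity \<open>j - k + 2\<close> that a large 2-index would contribute, evaluated
  at the small ones, so that subtracting it from the full sum leaves the large
  contributions.\<close>

definition capped_two_index :: "nat \<Rightarrow> int \<Rightarrow> int \<Rightarrow> int \<Rightarrow> int \<Rightarrow> real" where
  "capped_two_index k J Q x y =
    (\<Sum>s\<in>{0..J}. of_bool (s * y \<le> Q + x) * of_bool (Q + x < (s + 1) * y) * (real_of_int s - real k + 2))"

lemma lin_combination:
  obtains Z where "\<And>Q a b. lin Z Q a b = s * lin X Q a b + t * lin Y Q a b + r * Q"
proof -
  obtain u v w u' v' w' where "X = (u, v, w)" "Y = (u', v', w')" by (metis prod_cases3)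
  thus ?thesis
    by (intro that[of "(s * u + t * u', s * v + t * v', s * w + t * w' + r)"])
      (simp add: lin_def algebra_simps)
qed

lemma tame_index_indicator:
  "tame (\<lambda>Q a b. of_bool (s * lin Y Q a b \<le> Q + lin X Q a b) * of_bool (Q + lin X Q a b < (s + 1) * lin Y Q a b))"
proof -
  obtain Z where Z: "\<And>Q a b. lin Z Q a b = 1 * lin X Q a b + (- s) * lin Y Q a b + 1 * Q"
    using lin_combination by metis
  obtain Z' where Z': "\<And>Q a b. lin Z' Q a b = 1 * lin X Q a b + (- (s + 1)) * lin Y Q a b + 1 * Q"
    using lin_combination by metis
  have "s * lin Y Q a b \<le> Q + lin X Q a b \<longleftrightarrow> lin Z Q a b \<ge> 0"
    "Q + lin X Q a b < (s + 1) * lin Y Q a b \<longleftrightarrow> lin Z' Q a b < 0" for Q a b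
    unfolding Z Z' by (auto simp: algebra_simps)
  thus ?thesis by (simp only:) (intro tame_mult tame_indicator tame_not_indicator)
qed

text \<open>A step sends \<open>(x, y)\<close> to \<open>(y, s * y - x)\<close> with constant
  \<open>s\<close>, again linear forms; the induction therefore needs arbitrary forms
  \<open>X\<close>, \<open>Y\<close> instead of the coordinates.\<close>

lemma tame_capped_continuant:
  "tame (\<lambda>Q a b. capped_continuant J n Q (lin X Q a b) (lin Y Q a b) c d)"
proof (induction n arbitrary: X Y c d)
  case (Suc n)
  have "tame (\<lambda>Q a b. capped_continuant J n Q (lin Y Q a b) (s * lin Y Q a b - lin X Q a b) d (s * d - c))" for s
  proof -
    obtain Z where "\<And>Q a b. lin Z Q a b = s * lin Y Q a b + (- 1) * lin X Q a b + 0 * Q"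
      using lin_combination by metis
    hence "s * lin Y Q a b - lin X Q a b = lin Z Q a b" for Q a b by simp
    thus ?thesis by (simp only: Suc)
  qed
  thus ?case unfolding capped_continuant.simps
    by (intro tame_sum tame_mult[OF tame_index_indicator]) auto
qed (simp add: tame_const)

lemma lin_coordinates:
  "lin (1, 0, 0) Q a b = a" "lin (0, 1, 0) Q a b = b"
  by (simp_all add: lin_def)

section \<open>Sums over the triangle and over one period\<close>

definition triangle :: "int \<Rightarrow> int \<Rightarrow> int \<Rightarrow> real" where
  "triangle Q a b = of_bool (a \<le> Q) * of_bool (b \<le> Q) * of_bool (Q < a + b)"

lemma tame_triangle: "tame triangle"
proof -
  have "a \<le> Q \<longleftrightarrow> lin (- 1, 0, 1) Q a b \<ge> 0" "b \<le> Q \<longleftrightarrow> lin (0, - 1, 1) Q a b \<ge> 0"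
    "Q < a + b \<longleftrightarrow> lin (- 1, - 1, 1) Q a b < 0" for Q a b
    by (auto simp: lin_def)
  hence eq: "triangle = (\<lambda>Q a b. of_bool (lin (- 1, 0, 1) Q a b \<ge> 0) * of_bool (lin (0, - 1, 1) Q a b \<ge> 0) *
      of_bool (lin (- 1, - 1, 1) Q a b < 0))"
    by (simp add: triangle_def fun_eq_iff)
  show ?thesis by (subst eq) (intro tame_mult tame_indicator tame_not_indicator)
qed

lemma sum_triangle:
  assumes "Q \<ge> 0"
  shows "(\<Sum>a\<in>{1..Q}. \<Sum>b\<in>{1..Q}. triangle Q a b) = real_of_int Q * (real_of_int Q + 1) / 2"
proof -
  have "(\<Sum>b\<in>{1..Q}. triangle Q a b) = real_of_int a" if "a \<in> {1..Q}" for a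
  proof -
    have "(\<Sum>b\<in>{1..Q}. triangle Q a b) = (\<Sum>b\<in>{Q - a + 1..Q}. 1)"
      using that by (intro sum.mono_neutral_cong_right) (auto simp: triangle_def)
    thus ?thesis using that by simp
  qed
  hence "(\<Sum>a\<in>{1..Q}. \<Sum>b\<in>{1..Q}. triangle Q a b) = (\<Sum>a\<in>{1..Q}. real_of_int a)"
    by (intro sum.cong) auto
  also have "\<dots> = real_of_int Q * (real_of_int Q + 1) / 2"
    using assms
  proof (induction Q rule: int_ge_induct)
    case (step n)
    have "{1..n+1} = insert (n+1) {1..n}" using step by auto
    thus ?case using step.IH by (simp add: field_simps)
  qed simp
  finally show ?thesis .
qed

lemma sum_coprime_triangle:
  "(\<Sum>a\<in>{1..Q}. \<Sum>b\<in>{1..Q}. of_bool (coprime a b) * (triangle Q a b * h a b)) = (\<Sum>(a, b)\<in>farey_pairs Q. h a b)"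
proof -
  have "(\<Sum>a\<in>{1..Q}. \<Sum>b\<in>{1..Q}. of_bool (coprime a b) * (triangle Q a b * h a b)) =
    (\<Sum>(a, b)\<in>{1..Q} \<times> {1..Q}. of_bool (coprime a b) * (triangle Q a b * h a b))"
    by (simp only: sum.cartesian_product)
  also have "\<dots> = (\<Sum>(a, b)\<in>farey_pairs Q. h a b)"
    by (intro sum.mono_neutral_cong_right) (auto simp: farey_pairs_def triangle_def)
  finally show ?thesis .
qed

lemma sum_periodic_shift:
  fixes g :: "int \<Rightarrow> real"
  assumes "\<And>i. g (i + N) = g i" "N > 0"
  shows "(\<Sum>i\<in>{1..N}. g (i + int s)) = (\<Sum>i\<in>{1..N}. g i)"
proof (induction s)
  case (Suc s)
  have "(\<Sum>i\<in>{1..N}. g (i + int (Suc s))) = (\<Sum>i\<in>{2..N+1}. g (i + int s))"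
    by (rule sum.reindex_bij_witness[of _ "\<lambda>i. i - 1" "\<lambda>i. i + 1"]) (auto simp: add_ac)
  also have "\<dots> = (\<Sum>i\<in>insert (N + 1) {2..N}. g (i + int s))"
    using assms(2) by (intro sum.cong) auto
  also have "\<dots> = g (1 + int s + N) + (\<Sum>i\<in>{2..N}. g (i + int s))" by (simp add: add_ac)
  also have "g (1 + int s + N) = g (1 + int s)" by (rule assms(1))
  also have "g (1 + int s) + (\<Sum>i\<in>{2..N}. g (i + int s)) = (\<Sum>i\<in>insert 1 {2..N}. g (i + int s))"
    by simp
  also have "insert 1 {2..N} = {1..N}" using assms(2) by auto
  finally show ?case using Suc by simp
qed simp

lemma sum_farey_pairs:
  assumes "Q \<ge> 1"
  shows "(\<Sum>i\<in>{1..int (farey_N Q)}. h (farey_q Q (i - 1)) (farey_q Q i)) = (\<Sum>(a, b)\<in>farey_pairs (int Q). h a b)"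
  using sum.reindex_bij_betw[OF bij_betw_farey_pairs[OF assms], of "\<lambda>(a, b). h a b"] by simp

lemma card_farey_pairs: "Q \<ge> 1 \<Longrightarrow> card (farey_pairs (int Q)) = farey_N Q"
  using bij_betw_same_card[OF bij_betw_farey_pairs] by simp

lemma two_index_shift:
  assumes "Q \<ge> 1"
  shows "k_index Q 2 (i + int (farey_N Q)) = k_index Q 2 i"
proof -
  have s: "farey_q Q (l + int (farey_N Q)) = farey_q Q l" for l
    using farey_q_shift[OF assms, of l 1] by simp
  have "k_index Q 2 (i + int (farey_N Q)) * farey_q Q (i + int (farey_N Q)) = k_index Q 2 i * farey_q Q i"
    using farey_recurrence(1)[OF assms, of i] farey_recurrence(1)[OF assms, of "i + int (farey_N Q)"]
      s[of "i + 1"] s[of "i - 1"] by (simp add: add_ac diff_add_eq)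
  thus ?thesis using farey_q_pos[of Q i] s[of i] by simp
qed

lemma sum_two_index:
  assumes "Q \<ge> 1"
  shows "(\<Sum>i\<in>{1..int (farey_N Q)}. real_of_int (k_index Q 2 i)) = 3 * real (farey_N Q) - 1"
proof -
  define N where "N = int (farey_N Q)"
  have N: "N > 0" using farey_N_pos[OF assms] by (simp add: N_def)
  define q where "q i = real_of_int (farey_q Q i)" for i
  have qpos: "q i > 0" for i using farey_q_pos by (simp add: q_def)
  have per: "q (i + N) = q i" for i using farey_q_shift[OF assms, of i 1] by (simp add: q_def N_def)
  have "real_of_int (k_index Q 2 i) = q (i + 1) / q i + q (i - 1) / q i" for i
  proof -
    have "q (i + 1) + q (i - 1) = real_of_int (k_index Q 2 i) * q i"
      using farey_recurrence(1)[OF assms, of i] unfolding q_def by (metis of_int_add of_int_mult)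
    thus ?thesis using qpos[of i] by (simp add: field_simps)
  qed
  hence "(\<Sum>i\<in>{1..N}. real_of_int (k_index Q 2 i)) = (\<Sum>i\<in>{1..N}. q (i + 1) / q i) + (\<Sum>i\<in>{1..N}. q (i - 1) / q i)"
    by (simp add: sum.distrib)
  also have "(\<Sum>i\<in>{1..N}. q (i + 1) / q i) = (\<Sum>i\<in>{1..N}. q i / q (i - 1))"
  proof -
    have "q (i + N) / q (i + N - 1) = q i / q (i - 1)" for i
      using per[of i] per[of "i - 1"] by (simp add: algebra_simps)
    from sum_periodic_shift[of "\<lambda>i. q i / q (i - 1)", OF this N, of 1] show ?thesis by simp
  qed
  also have "(\<Sum>i\<in>{1..N}. q i / q (i - 1)) + (\<Sum>i\<in>{1..N}. q (i - 1) / q i) =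
      (\<Sum>i\<in>{1..N}. q (i - 1) / q i + q i / q (i - 1))"
    by (simp add: sum.distrib add.commute)
  also have "\<dots> = (\<Sum>(a, b)\<in>farey_pairs (int Q). real_of_int a / real_of_int b + real_of_int b / real_of_int a)"
    unfolding q_def N_def
    by (rule sum_farey_pairs[OF assms, where h = "\<lambda>a b. real_of_int a / real_of_int b + real_of_int b / real_of_int a"])
  also have "\<dots> = 3 * real (farey_N Q) - 1"
    using hall_shiu[of "int Q"] assms by (simp add: card_farey_pairs)
  finally show ?thesis by (simp add: N_def)
qed

text \<open>Since \<open>q (i + 1)\<close> lies above \<open>Q - q i\<close> and is at most
  \<open>Q\<close>, the 2-index is the floor of \<open>(Q + q (i - 1)) / q i\<close>. This makes it
  a function of two neighbouring denominators.\<close>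

lemma two_index_unique:
  assumes "Q \<ge> 1"
  shows "s * farey_q Q i \<le> int Q + farey_q Q (i - 1) \<and> int Q + farey_q Q (i - 1) < (s + 1) * farey_q Q i \<longleftrightarrow>
    s = k_index Q 2 i"
proof -
  define y j where "y = farey_q Q i" and "j = k_index Q 2 i"
  have y: "y > 0" by (simp add: y_def farey_q_pos)
  have "farey_q Q (i + 1) + farey_q Q (i - 1) = j * y"
    using farey_recurrence(1)[OF assms] by (simp add: y_def j_def)
  moreover have "farey_q Q (i + 1) \<le> int Q" "farey_q Q (i + 1) > int Q - y"
    using farey_q_le[OF assms] farey_neighbours(2)[OF assms, of i] by (auto simp: y_def)
  ultimately have z: "j * y \<le> int Q + farey_q Q (i - 1)" "int Q + farey_q Q (i - 1) < (j + 1) * y"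
    by (auto simp: algebra_simps)
  have "s = j" if "s * y \<le> int Q + farey_q Q (i - 1)" "int Q + farey_q Q (i - 1) < (s + 1) * y"
  proof -
    have "s * y < (j + 1) * y" "j * y < (s + 1) * y" using z that by linarith+
    thus ?thesis using y by simp
  qed
  thus ?thesis using z by (auto simp: y_def j_def)
qed

lemma sum_two_index_indicator:
  fixes h :: "int \<Rightarrow> real"
  assumes "Q \<ge> 1"
  shows "(\<Sum>s\<in>{0..J}. of_bool (s * farey_q Q i \<le> int Q + farey_q Q (i - 1)) *
      of_bool (int Q + farey_q Q (i - 1) < (s + 1) * farey_q Q i) * h s) =
    of_bool (k_index Q 2 i \<le> J) * h (k_index Q 2 i)"
proof -
  have "(\<Sum>s\<in>{0..J}. of_bool (s * farey_q Q i \<le> int Q + farey_q Q (i - 1)) *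
      of_bool (int Q + farey_q Q (i - 1) < (s + 1) * farey_q Q i) * h s) =
    (\<Sum>s\<in>{0..J}. if s = k_index Q 2 i then h s else 0)"
    using two_index_unique[OF assms, of _ i] by (intro sum.cong) (auto simp flip: of_bool_conj)
  also have "\<dots> = of_bool (k_index Q 2 i \<le> J) * h (k_index Q 2 i)"
    using two_index_pos[OF assms, of i] by simp
  finally show ?thesis .
qed

lemma capped_two_index_farey:
  assumes "Q \<ge> 1"
  shows "capped_two_index k J (int Q) (farey_q Q (i - 1)) (farey_q Q i) =
    of_bool (k_index Q 2 i \<le> J) * (real_of_int (k_index Q 2 i) - real k + 2)"
  unfolding capped_two_index_def by (rule sum_two_index_indicator[OF assms])

text \<open>The base point \<open>e\<close> stays fixed while the induction moves \<open>i\<close>;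
  it is later set to \<open>i - 1\<close>.\<close>

lemma capped_continuant_farey:
  assumes "Q \<ge> 1"
  shows "capped_continuant J n (int Q) (farey_q Q (i - 1)) (farey_q Q i) (farey_det Q e (i - 1)) (farey_det Q e i) =
    of_bool (\<forall>s<n. k_index Q 2 (i + int s) \<le> J) * real_of_int (farey_det Q e (i + int n))"
proof (induction n arbitrary: i)
  case (Suc n)
  have q: "k_index Q 2 i * farey_q Q i - farey_q Q (i - 1) = farey_q Q (i + 1)"
    using farey_recurrence(1)[OF assms, of i] by simp
  have "capped_continuant J (Suc n) (int Q) (farey_q Q (i - 1)) (farey_q Q i) (farey_det Q e (i - 1)) (farey_det Q e i) =
    of_bool (k_index Q 2 i \<le> J) * capped_continuant J n (int Q) (farey_q Q i) (farey_q Q (i + 1))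
      (farey_det Q e i) (farey_det Q e (i + 1))"
    unfolding capped_continuant.simps sum_two_index_indicator[OF assms] q farey_det_step[OF assms] ..
  also have "\<dots> = of_bool (k_index Q 2 i \<le> J) * (of_bool (\<forall>s<n. k_index Q 2 (i + 1 + int s) \<le> J) *
      real_of_int (farey_det Q e (i + 1 + int n)))"
    using Suc[of "i + 1"] by simp
  also have "of_bool (k_index Q 2 i \<le> J) * (of_bool (\<forall>s<n. k_index Q 2 (i + 1 + int s) \<le> J) *
      real_of_int (farey_det Q e (i + 1 + int n))) =
    of_bool (\<forall>s<Suc n. k_index Q 2 (i + int s) \<le> J) * real_of_int (farey_det Q e (i + int (Suc n)))"
    by (simp add: All_less_Suc2 add.assoc flip: of_bool_conj)
  finally show ?case .
qed simp

text \<open>Among the 2-indices entering \<open>k_index Q k i\<close> at most one exceeds \<open>J\<close>, and if one does then the \<open>k\<close>-index is that one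
  minus \<open>k - 2\<close>.\<close>

lemma k_index_split:
  assumes Q: "Q \<ge> 1" and k: "k \<ge> 1" and J: "J = 4 * int k + 2"
  shows "real_of_int (k_index Q k i) =
    capped_continuant J (k - 1) (int Q) (farey_q Q (i - 1)) (farey_q Q i) 0 1 +
    (\<Sum>s<k - 1. of_bool (k_index Q 2 (i + int s) > J) * (real_of_int (k_index Q 2 (i + int s)) - real k + 2))"
proof -
  \<comment> \<open>The determinants 0 and 1 are the starting values of the continuant;
    \<open>k - 1\<close> steps from \<open>i\<close> reach the right end of the
    \<open>k\<close>-index.\<close>
  have ends: "farey_det Q (i - 1) (i - 1) = 0" "farey_det Q (i - 1) i = 1" "i - 1 + int k = i + int (k - 1)"
    using farey_neighbours(1)[OF Q, of "i - 1"] k by (simp_all add: farey_det_def of_nat_diff)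
  have cc: "capped_continuant J (k - 1) (int Q) (farey_q Q (i - 1)) (farey_q Q i) 0 1 =
    of_bool (\<forall>s<k - 1. k_index Q 2 (i + int s) \<le> J) * real_of_int (k_index Q k i)"
    using capped_continuant_farey[OF Q, of J "k - 1" i "i - 1"] by (simp add: ends k_index_eq_det)
  show ?thesis
  proof (cases "\<forall>s<k - 1. k_index Q 2 (i + int s) \<le> J")
    case True
    hence "of_bool (k_index Q 2 (i + int s) > J) = (0 :: real)" if "s < k - 1" for s
      using that by (simp add: not_less)
    thus ?thesis unfolding cc using True by simp
  next
    case False
    then obtain s where s: "s < k - 1" "k_index Q 2 (i + int s) > J" by (auto simp: not_le)
    define t where "t = i + int s"
    note big = big_two_index[OF Q, of k t "int s + 1" "int k - 1 - int s"]
    have range: "1 \<le> int s + 1" "1 \<le> int k - 1 - int s" "int s + 1 + (int k - 1 - int s) = int k"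
      "k_index Q 2 t > 4 * int k + 2" using s J by (auto simp: t_def)
    have te: "t - (int s + 1) = i - 1" "t + (int k - 1 - int s) = i - 1 + int k" by (simp_all add: t_def)
    have "k_index Q k i = k_index Q 2 t - int k + 2"
      using big(1)[OF range(4,1,2,3)] unfolding te k_index_eq_det[of Q k] .
    moreover have "k_index Q 2 (i + int s') \<le> J" if "s' < k - 1" "s' \<noteq> s" for s'
    proof -
      have "int s' < int k - 1" using that by linarith
      thus ?thesis using big(2)[OF range(4,1,2,3), of "i + int s'"] that J unfolding te t_def by auto
    qed
    hence "(\<Sum>s'<k - 1. of_bool (k_index Q 2 (i + int s') > J) * (real_of_int (k_index Q 2 (i + int s')) - real k + 2)) =
      (\<Sum>s'\<in>{s}. of_bool (k_index Q 2 (i + int s') > J) * (real_of_int (k_index Q 2 (i + int s')) - real k + 2))"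
      using s by (intro sum.mono_neutral_right) (auto simp: not_less)
    ultimately show ?thesis unfolding cc using False s by (simp add: t_def)
  qed
qed

definition bounded_part :: "nat \<Rightarrow> int \<Rightarrow> int \<Rightarrow> int \<Rightarrow> real" where
  "bounded_part k Q a b = capped_continuant (4 * int k + 2) (k - 1) Q a b 0 1
    - (real k - 1) * capped_two_index k (4 * int k + 2) Q a b"

lemma tame_bounded_part: "tame (bounded_part k)"
proof -
  have c: "tame (\<lambda>Q a b. capped_continuant J n Q a b c d)" for J n c d
    using tame_capped_continuant[of J n "(1, 0, 0)" "(0, 1, 0)" c d] by (simp add: lin_coordinates)
  have "tame (\<lambda>Q a b. of_bool (s * b \<le> Q + a) * of_bool (Q + a < (s + 1) * b))" for s
    using tame_index_indicator[of s "(0, 1, 0)" "(1, 0, 0)"] by (simp add: lin_coordinates)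
  hence "tame (\<lambda>Q a b. capped_two_index k J Q a b)" for J
    unfolding capped_two_index_def by (intro tame_sum tame_mult[OF _ tame_const]) auto
  hence "tame (\<lambda>Q a b. capped_continuant (4 * int k + 2) (k - 1) Q a b 0 1 +
      (1 - real k) * capped_two_index k (4 * int k + 2) Q a b)"
    by (intro tame_add c tame_mult[OF tame_const])
  also have "(\<lambda>Q a b. capped_continuant (4 * int k + 2) (k - 1) Q a b 0 1 +
      (1 - real k) * capped_two_index k (4 * int k + 2) Q a b) = bounded_part k"
    by (simp add: fun_eq_iff bounded_part_def algebra_simps)
  finally show ?thesis .
qed

text \<open>By periodicity each shift \<open>s\<close> contributes the same sum of large terms. Over
  all 2-indices, \<open>j - k + 2\<close> adds up to \<open>3 * N - 1 + (2 - k) * N\<close>, the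
  source of \<open>5 - k\<close>; the small ones are moved into \<open>bounded_part\<close>.\<close>

lemma sum_k_index:
  assumes Q: "Q \<ge> 1" and k: "k \<ge> 1"
  shows "(\<Sum>i = 1..int (farey_N Q). real_of_int (k_index Q k i)) =
    (\<Sum>(a, b)\<in>farey_pairs (int Q). bounded_part k (int Q) a b) + (real k - 1) * ((5 - real k) * real (farey_N Q) - 1)"
proof -
  define N where "N = int (farey_N Q)"
  have N: "N > 0" using farey_N_pos[OF Q] by (simp add: N_def)
  define J where "J = 4 * int k + 2"
  define j where "j i = real_of_int (k_index Q 2 i) - real k + 2" for i
  define g where "g i = of_bool (k_index Q 2 i > J) * j i" for i
  define c where "c i = capped_continuant J (k - 1) (int Q) (farey_q Q (i - 1)) (farey_q Q i) 0 1" for i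
  define w where "w i = capped_two_index k J (int Q) (farey_q Q (i - 1)) (farey_q Q i)" for i
  have g: "g i = j i - w i" for i
    by (auto simp: g_def w_def j_def capped_two_index_farey[OF Q])
  have "(\<Sum>i\<in>{1..N}. real_of_int (k_index Q k i)) = (\<Sum>i\<in>{1..N}. c i) + (\<Sum>i\<in>{1..N}. \<Sum>s<k - 1. g (i + int s))"
    by (simp add: k_index_split[OF Q k J_def] c_def g_def j_def sum.distrib)
  also have "(\<Sum>i\<in>{1..N}. \<Sum>s<k - 1. g (i + int s)) = (\<Sum>s<k - 1. \<Sum>i\<in>{1..N}. g (i + int s))"
    by (rule sum.swap)
  also have "\<dots> = (\<Sum>s<k - 1. \<Sum>i\<in>{1..N}. g i)"
  proof -
    have "g (i + N) = g i" for i using two_index_shift[OF Q, of i] by (simp add: g_def j_def N_def)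
    thus ?thesis using sum_periodic_shift[OF _ N] by simp
  qed
  also have "\<dots> = (real k - 1) * (\<Sum>i\<in>{1..N}. g i)" using k by (simp add: of_nat_diff)
  also have "(\<Sum>i\<in>{1..N}. g i) = (\<Sum>i\<in>{1..N}. real_of_int (k_index Q 2 i)) + (2 - real k) * real (farey_N Q) - (\<Sum>i\<in>{1..N}. w i)"
    by (simp add: g j_def sum.distrib sum_subtractf N_def algebra_simps)
  also have "(\<Sum>i\<in>{1..N}. real_of_int (k_index Q 2 i)) = 3 * real (farey_N Q) - 1"
    unfolding N_def by (rule sum_two_index[OF Q])
  finally have "(\<Sum>i\<in>{1..N}. real_of_int (k_index Q k i)) = (\<Sum>i\<in>{1..N}. c i) - (real k - 1) * (\<Sum>i\<in>{1..N}. w i)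
      + (real k - 1) * ((5 - real k) * real (farey_N Q) - 1)"
    by (simp add: algebra_simps)
  also have "(\<Sum>i\<in>{1..N}. c i) - (real k - 1) * (\<Sum>i\<in>{1..N}. w i) =
      (\<Sum>i\<in>{1..N}. bounded_part k (int Q) (farey_q Q (i - 1)) (farey_q Q i))"
    by (simp add: bounded_part_def c_def w_def J_def sum_subtractf sum_distrib_left)
  also have "\<dots> = (\<Sum>(a, b)\<in>farey_pairs (int Q). bounded_part k (int Q) a b)"
    unfolding N_def by (rule sum_farey_pairs[OF Q])
  finally show ?thesis by (simp add: N_def)
qed

text \<open>The factor \<open>1 / 8\<close> is the bound \<open>1 / 4\<close> for the Moebius sum
  times the area \<open>1 / 2\<close> of the triangle.\<close>

lemma farey_N_lower_bound:
  obtains C :: real where "\<And>Q. Q \<ge> 1 \<Longrightarrow> (real Q)\<^sup>2 / 8 - C * real Q * (1 + ln (real Q)) \<le> real (farey_N Q)"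
proof -
  obtain C :: real where C: "\<And>Q :: nat. Q \<ge> 1 \<Longrightarrow>
      \<bar>(\<Sum>a\<in>{1..int Q}. \<Sum>b\<in>{1..int Q}. of_bool (coprime a b) * triangle (int Q) a b)
        - (\<Sum>d = 1..Q. mu d / (real d)\<^sup>2) * (\<Sum>a\<in>{1..int Q}. \<Sum>b\<in>{1..int Q}. triangle (int Q) a b)\<bar>
      \<le> C * real Q * (1 + ln (real Q))"
    by (rule tame_coprime_sum[OF tame_triangle]) (auto simp: triangle_def)
  show ?thesis
  proof (rule that[of C])
    fix Q :: nat assume Q: "Q \<ge> 1"
    have "(\<Sum>a\<in>{1..int Q}. \<Sum>b\<in>{1..int Q}. of_bool (coprime a b) * triangle (int Q) a b) = real (farey_N Q)"
      using sum_coprime_triangle[of "int Q" "\<lambda>_ _. 1"] card_farey_pairs[OF Q] by simp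
    hence "(\<Sum>d = 1..Q. mu d / (real d)\<^sup>2) * (real Q * (real Q + 1) / 2) \<le> real (farey_N Q) + C * real Q * (1 + ln (real Q))"
      using C[OF Q] sum_triangle[of "int Q"] by simp
    moreover have "1 / 4 * ((real Q)\<^sup>2 / 2) \<le> (\<Sum>d = 1..Q. mu d / (real d)\<^sup>2) * (real Q * (real Q + 1) / 2)"
      using sum_mu_square_bounds(1)[OF Q] by (intro mult_mono) (auto simp: power2_eq_square algebra_simps)
    ultimately show "(real Q)\<^sup>2 / 8 - C * real Q * (1 + ln (real Q)) \<le> real (farey_N Q)" by simp
  qed
qed

lemma sum_bounded_part_asymptotic:
  obtains B C :: real where "C \<ge> 0" "\<And>Q :: nat. Q \<ge> 1 \<Longrightarrow>
    \<bar>(\<Sum>(a, b)\<in>farey_pairs (int Q). bounded_part k (int Q) a b) - B * real (farey_N Q)\<bar> \<le> C * real Q * (1 + ln (real Q))"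
proof -
  define h where "h Q a b = triangle Q a b * bounded_part k Q a b" for Q a b
  have "tame h" using tame_mult[OF tame_triangle tame_bounded_part[of k]] by (simp add: h_def[abs_def])
  obtain I C :: real where C: "C \<ge> 0"
    "\<And>Q. Q \<ge> 1 \<Longrightarrow> \<bar>(\<Sum>a\<in>{1..Q}. \<Sum>b\<in>{1..Q}. h Q a b) - I * (real_of_int Q)\<^sup>2\<bar> \<le> C * real_of_int Q"
    by (rule tame_limit[OF \<open>tame h\<close>]) auto
  \<comment> \<open>\<open>2 * I\<close> is the mean over the triangle, so \<open>f\<close> has
    integral 0 and its full lattice sum is \<open>O(Q)\<close>.\<close>
  define f where "f Q a b = triangle Q a b * (bounded_part k Q a b - 2 * I)" for Q a b
  have fh: "f = (\<lambda>Q a b. h Q a b + (- 2 * I) * triangle Q a b)"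
    by (auto simp: f_def h_def fun_eq_iff algebra_simps)
  have "tame f" unfolding fh by (intro tame_add \<open>tame h\<close> tame_mult tame_const tame_triangle)
  moreover have "f Q a b = 0" if "a > Q \<or> b > Q" for Q a b using that by (auto simp: f_def triangle_def)
  ultimately obtain C' :: real where C': "C' \<ge> 0" "\<And>Q :: nat. Q \<ge> 1 \<Longrightarrow>
      \<bar>(\<Sum>a\<in>{1..int Q}. \<Sum>b\<in>{1..int Q}. of_bool (coprime a b) * f (int Q) a b)
        - (\<Sum>d = 1..Q. mu d / (real d)\<^sup>2) * (\<Sum>a\<in>{1..int Q}. \<Sum>b\<in>{1..int Q}. f (int Q) a b)\<bar>
      \<le> C' * real Q * (1 + ln (real Q))"
    using tame_coprime_sum[of f] by blast
  define D where "D = 2 * (C + \<bar>I\<bar>)"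
  show ?thesis
  proof (rule that[of "D + C'" "2 * I"])
    show "D + C' \<ge> 0" using C C' by (simp add: D_def)
    fix Q :: nat assume Q: "Q \<ge> 1"
    define M where "M = (\<Sum>d = 1..Q. mu d / (real d)\<^sup>2)"
    define F where "F = (\<Sum>a\<in>{1..int Q}. \<Sum>b\<in>{1..int Q}. f (int Q) a b)"
    define P where "P = (\<Sum>a\<in>{1..int Q}. \<Sum>b\<in>{1..int Q}. of_bool (coprime a b) * f (int Q) a b)"
    have "F = (\<Sum>a\<in>{1..int Q}. \<Sum>b\<in>{1..int Q}. h (int Q) a b)
        + (- 2 * I) * (\<Sum>a\<in>{1..int Q}. \<Sum>b\<in>{1..int Q}. triangle (int Q) a b)"
      unfolding F_def fh by (simp only: sum.distrib sum_distrib_left)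
    also have "\<dots> = (\<Sum>a\<in>{1..int Q}. \<Sum>b\<in>{1..int Q}. h (int Q) a b) - 2 * I * (real Q * (real Q + 1) / 2)"
      using sum_triangle[of "int Q"] by simp
    also have "\<dots> = ((\<Sum>a\<in>{1..int Q}. \<Sum>b\<in>{1..int Q}. h (int Q) a b) - I * (real Q)\<^sup>2) - I * real Q"
      by (simp add: power2_eq_square algebra_simps)
    finally have "\<bar>F\<bar> \<le> C * real Q + \<bar>I\<bar> * real Q"
      using C(2)[of "int Q"] Q abs_triangle_ineq4[of "(\<Sum>a\<in>{1..int Q}. \<Sum>b\<in>{1..int Q}. h (int Q) a b) - I * (real Q)\<^sup>2" "I * real Q"]
      by (simp add: abs_mult)
    moreover have "\<bar>M * F\<bar> \<le> 2 * \<bar>F\<bar>"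
      unfolding abs_mult M_def using sum_mu_square_bounds(2)[OF Q] by (intro mult_right_mono) auto
    ultimately have MF: "\<bar>M * F\<bar> \<le> D * real Q" by (simp add: D_def algebra_simps)
    have "\<bar>P - M * F\<bar> \<le> C' * real Q * (1 + ln (real Q))" using C'(2)[OF Q] by (simp add: P_def M_def F_def)
    hence "\<bar>P\<bar> \<le> D * real Q * 1 + C' * real Q * (1 + ln (real Q))" using MF by linarith
    also have "\<dots> \<le> D * real Q * (1 + ln (real Q)) + C' * real Q * (1 + ln (real Q))"
      using Q C by (intro add_right_mono mult_left_mono) (auto simp: D_def)
    also have "P = (\<Sum>(a, b)\<in>farey_pairs (int Q). bounded_part k (int Q) a b - 2 * I)"
      unfolding P_def f_def by (rule sum_coprime_triangle)
    also have "\<dots> = (\<Sum>(a, b)\<in>farey_pairs (int Q). bounded_part k (int Q) a b) - 2 * I * real (farey_N Q)"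
      by (simp add: case_prod_unfold sum_subtractf card_farey_pairs[OF Q])
    finally show "\<bar>(\<Sum>(a, b)\<in>farey_pairs (int Q). bounded_part k (int Q) a b) - 2 * I * real (farey_N Q)\<bar>
        \<le> (D + C') * real Q * (1 + ln (real Q))" by (simp add: algebra_simps)
  qed
qed

theorem theorem2:
  fixes k :: nat
  assumes "k \<ge> 1"
  shows "\<exists>B :: real.
           (\<lambda>Q::nat. (\<Sum>i = 1..int (farey_N Q). real_of_int (k_index Q k i)) / real (farey_N Q) - B)
             \<in> O(\<lambda>Q. (ln (real Q))\<^sup>2 / real Q)"
proof -
  obtain C\<^sub>1 :: real where N: "\<And>Q. Q \<ge> 1 \<Longrightarrow> (real Q)\<^sup>2 / 8 - C\<^sub>1 * real Q * (1 + ln (real Q)) \<le> real (farey_N Q)"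
    using farey_N_lower_bound by metis
  obtain B C\<^sub>2 :: real where C: "C\<^sub>2 \<ge> 0" "\<And>Q :: nat. Q \<ge> 1 \<Longrightarrow>
      \<bar>(\<Sum>(a, b)\<in>farey_pairs (int Q). bounded_part k (int Q) a b) - B * real (farey_N Q)\<bar> \<le> C\<^sub>2 * real Q * (1 + ln (real Q))"
    using sum_bounded_part_asymptotic by metis
  \<comment> \<open>The summand \<open>k\<close> absorbs the \<open>k - 1\<close> left over from the
    \<open>- 1\<close> in the Hall-Shiu identity.\<close>
  define E where "E Q = C\<^sub>2 * real Q * (1 + ln (real Q)) + real k" for Q
  have "(\<lambda>Q. (\<Sum>i = 1..int (farey_N Q). real_of_int (k_index Q k i)) / real (farey_N Q)
      - (B + (real k - 1) * (5 - real k))) \<in> O(\<lambda>Q. E Q / (real Q)\<^sup>2)"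
  proof (rule bigoI)
    \<comment> \<open>Half of the quadratic term is given up to swallow the logarithmic one.\<close>
    have "\<forall>\<^sub>F Q in sequentially. (real Q)\<^sup>2 / 16 \<le> (real Q)\<^sup>2 / 8 - C\<^sub>1 * real Q * (1 + ln (real Q))"
      by real_asymp
    thus "\<forall>\<^sub>F Q in sequentially. norm ((\<Sum>i = 1..int (farey_N Q). real_of_int (k_index Q k i)) / real (farey_N Q)
        - (B + (real k - 1) * (5 - real k))) \<le> 16 * norm (E Q / (real Q)\<^sup>2)"
      using eventually_ge_at_top[of 1]
    proof eventually_elim
      case (elim Q)
      define n where "n = real (farey_N Q)"
      have n: "(real Q)\<^sup>2 / 16 \<le> n" using elim N[of Q] by (simp add: n_def)
      have "n > 0" using farey_N_pos elim by (simp add: n_def)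
      define S where "S = (\<Sum>(a, b)\<in>farey_pairs (int Q). bounded_part k (int Q) a b)"
      have "(\<Sum>i = 1..int (farey_N Q). real_of_int (k_index Q k i)) / n - (B + (real k - 1) * (5 - real k)) =
          (S - B * n - (real k - 1)) / n"
        using \<open>n > 0\<close> elim assms by (simp add: sum_k_index S_def[symmetric] n_def[symmetric] field_simps)
      also have "\<bar>\<dots>\<bar> = \<bar>S - B * n - (real k - 1)\<bar> / n" using \<open>n > 0\<close> by simp
      also have "\<dots> \<le> E Q / n"
        using C(2)[of Q] elim assms \<open>n > 0\<close>
        by (intro divide_right_mono) (auto simp: E_def S_def[symmetric] n_def[symmetric])
      also have "\<dots> \<le> E Q / ((real Q)\<^sup>2 / 16)"
        using n elim C(1) \<open>n > 0\<close> by (intro divide_left_mono) (auto simp: E_def)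
      also have "\<dots> \<le> 16 * \<bar>E Q / (real Q)\<^sup>2\<bar>" by (simp add: divide_right_mono)
      finally show ?case by (simp add: n_def)
    qed
  qed
  also have "(\<lambda>Q. E Q / (real Q)\<^sup>2) \<in> O(\<lambda>Q. (ln (real Q))\<^sup>2 / real Q)"
    unfolding E_def by real_asymp
  finally show ?thesis by blast
qed

end
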